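(* Let $\mathcal U$ be a variety with a difference term and let $(Q,B^{\tau})$ be central datum in $\mathcal U$. Consider the restriction of the inflation map (induced by the canonical homomorphism $\pi:Q\to Q/[1,1]$) $$\check\sigma:\mathrm{Ext}_{\mathcal U}(Q/[1,1],B^{\tau})\to H^{2}_{\mathcal U}(Q,B^{\tau}).$$ Then $[T]\in\operatorname{im}\check\sigma$ if and only if $[T]$ is the cohomology class of an extension $\rho:A\to Q$ realizing $(Q,B^{\tau})$ such that $\ker\rho\wedge[1_A,1_A]=0_A$.
   Context: Conventions. Algebras are universal algebras in a signature $\tau$; $[\alpha,\beta]$ is the term-condition commutator of congruences; $0_A,1_A$ are the least and greatest congruences of $A$ (written $0,1$). An algebra is abelian if $[1,1]=0$. A variety $\mathcal U$ has a difference term if there is a ternary term $m$ with $m(x,x,y)=y$ in $\mathcal U$ and $(x,m(x,y,y))\in[\alpha,\alpha]$ whenever $A\in\mathcal U$ and $(x,y)\in\alpha\in\mathrm{Con}\,A$; it is assumed throughout that $m$ is a fundamental operation symbol of $\tau$. An extension is a surjective homomorphism; it is central if its kernel $\alpha$ satisfies $[\alpha,1]=0$. Kernel algebras and central datum. A kernel algebra $B^{\tau}$ is a $\tau$-algebra on the universe of a unital module $B$ over a ring $R$ with $1$ in which each $f\in\tau$ is a module term $f^{B}(x_1,\ldots,x_n)=r_1x_1+\cdots+r_nx_n$ $(r_i\in R)$ and $m^{B}(x,y,z)=x-y+z$. Central datum $(Q,B^{\tau})$ in $\mathcal U$ is a kernel algebra $B^{\tau}\in\mathcal U$ and an algebra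 $Q\in\mathcal U$. Cocycles. A 2-cocycle for $(Q,B^{\tau})$ is a family $T=\{T_f:Q^{\mathrm{ar} f}\to B\}_{f\in\tau}$. The algebra $B^{\tau}\otimes^{T}Q$ has universe $B\times Q$ and operations $F_f((b_1,q_1),\ldots,(b_n,q_n))=(f^{B}(\vec b)+T_f(\vec q),f^{Q}(\vec q))$; $p_2$ is its second projection to $Q$. For a term $t$ define $t^{\partial,T}$ by $x^{\partial,T}=0$ for a variable and $f(t_1,\ldots,t_n)^{\partial,T}=f^{B}(t_1^{\partial,T},\ldots,t_n^{\partial,T})+T_f(t_1^{Q},\ldots,t_n^{Q})$. $T$ is $\mathcal U$-compatible if $t^{\partial,T}=g^{\partial,T}$ under all evaluations in $Q$ for every identity $t=g$ of $\mathcal U$. A 2-coboundary is a family $G_f(\vec x)=f^{B}(h(\vec x))-h(f^{Q}(\vec x))$ for some function $h:Q\to B$. Under pointwise addition, $H^{2}_{\mathcal U}(Q,B^{\tau})$ is the group of $\mathcal U$-compatible 2-cocycles modulo 2-coboundaries. A central extension $\rho:A\to Q$, $A\in\mathcal U$, realizes $(Q,B^{\tau})$ and has cohomology class $[T]$ if there is an isomorphism $\psi:A\to B^{\tau}\otimes^{T}Q$ with $p_2\circ\psi=\rho$, $T$ being $\mathcal U$-compatible. $\mathrm{Ext}_{\mathcal U}(P,B^{\tau})\le H^{2}_{\mathcal U}(P,B^{\tau})$ is the subgroup of classes $[S]$ such that $B^{\tau}\otimes^{S}P$ is an abelian algebra. For a surjective homomorphism $\pi:Q\to P$, the inflation map $\check\sigma:H^{2}_{\mathcal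 U}(P,B^{\tau})\to H^{2}_{\mathcal U}(Q,B^{\tau})$ is $\check\sigma([S])=[S\circ\pi]$, $(S\circ\pi)_f(\vec q)=S_f(\pi(q_1),\ldots,\pi(q_n))$. *)

theory Defs
  imports "HOL-Algebra.Module" "HOL-Algebra.Coset"
begin

section \<open>Universal algebra\<close>

text \<open>
  A signature is a type \<open>'f\<close> of operation symbols with an arity function \<open>ar\<close>. An operation of an
  algebra is applied to the list of its arguments; only lists of length \<open>ar f\<close> over the carrier
  matter. Universes are nonempty.
\<close>

record ('f, 'a) ualg = "'a partial_object" +
  oper :: "'f \<Rightarrow> 'a list \<Rightarrow> 'a"

definition tuples :: "'a set \<Rightarrow> nat \<Rightarrow> 'a list set" where
  "tuples X n = {xs. set xs \<subseteq> X \<and> length xs = n}"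

definition ualgebra :: "('f \<Rightarrow> nat) \<Rightarrow> ('f, 'a) ualg \<Rightarrow> bool" where
  "ualgebra ar A \<longleftrightarrow> carrier A \<noteq> {} \<and>
     (\<forall>f. \<forall>xs\<in>tuples (carrier A) (ar f). oper A f xs \<in> carrier A)"

datatype ('f, 'x) trm = Var 'x | App 'f "('f, 'x) trm list"

primrec wf_trm :: "('f \<Rightarrow> nat) \<Rightarrow> ('f, 'x) trm \<Rightarrow> bool" where
  "wf_trm ar (Var x) \<longleftrightarrow> True"
| "wf_trm ar (App f ts) \<longleftrightarrow> length ts = ar f \<and> list_all (wf_trm ar) ts"

primrec eval_trm :: "('f, 'a) ualg \<Rightarrow> ('x \<Rightarrow> 'a) \<Rightarrow> ('f, 'x) trm \<Rightarrow> 'a" where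
  "eval_trm A v (Var x) = v x"
| "eval_trm A v (App f ts) = oper A f (map (eval_trm A v) ts)"

definition satisfies :: "('f, 'a) ualg \<Rightarrow> ('f, 'x) trm \<times> ('f, 'x) trm \<Rightarrow> bool" where
  "satisfies A = (\<lambda>(s, t). \<forall>v \<in> UNIV \<rightarrow> carrier A. eval_trm A v s = eval_trm A v t)"

definition ua_hom :: "('f \<Rightarrow> nat) \<Rightarrow> ('f, 'a) ualg \<Rightarrow> ('f, 'b) ualg \<Rightarrow> ('a \<Rightarrow> 'b) set" where
  "ua_hom ar A B = {\<phi> \<in> carrier A \<rightarrow> carrier B.
     \<forall>f. \<forall>xs\<in>tuples (carrier A) (ar f). \<phi> (oper A f xs) = oper B f (map \<phi> xs)}"

definition ua_iso :: "('f \<Rightarrow> nat) \<Rightarrow> ('f, 'a) ualg \<Rightarrow> ('f, 'b) ualg \<Rightarrow> ('a \<Rightarrow> 'b) set" where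
  "ua_iso ar A B = {\<phi> \<in> ua_hom ar A B. bij_betw \<phi> (carrier A) (carrier B)}"

subsection \<open>Congruences and the term-condition commutator\<close>

definition congruences :: "('f \<Rightarrow> nat) \<Rightarrow> ('f, 'a) ualg \<Rightarrow> 'a rel set" where
  "congruences ar A = {\<theta>. equiv (carrier A) \<theta> \<and>
     (\<forall>f. \<forall>xs\<in>tuples (carrier A) (ar f). \<forall>ys\<in>tuples (carrier A) (ar f).
        list_all2 (\<lambda>x y. (x, y) \<in> \<theta>) xs ys \<longrightarrow> (oper A f xs, oper A f ys) \<in> \<theta>)}"

definition least_cong :: "('f, 'a) ualg \<Rightarrow> 'a rel" where
  "least_cong A = Id_on (carrier A)"

definition greatest_cong :: "('f, 'a) ualg \<Rightarrow> 'a rel" where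
  "greatest_cong A = carrier A \<times> carrier A"

definition ker_cong :: "('f, 'a) ualg \<Rightarrow> ('a \<Rightarrow> 'b) \<Rightarrow> 'a rel" where
  "ker_cong A \<phi> = {(x, y) \<in> carrier A \<times> carrier A. \<phi> x = \<phi> y}"

definition quotient_ualg :: "('f, 'a) ualg \<Rightarrow> 'a rel \<Rightarrow> ('f, 'a set) ualg" where
  "quotient_ualg A \<theta> =
     \<lparr>carrier = carrier A // \<theta>,
      oper = (\<lambda>f Xs. \<Union>xs\<in>listset Xs. \<theta> `` {oper A f xs})\<rparr>"

definition canonical_hom :: "'a rel \<Rightarrow> 'a \<Rightarrow> 'a set" where
  "canonical_hom \<theta> x = \<theta> `` {x}"

text \<open>
  The condition \<open>C(\<alpha>, \<beta>; \<delta>)\<close>. The variables \<open>Inl i\<close> of \<open>t\<close> form the first block of arguments and the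
  variables \<open>Inr j\<close> the second. Only finitely many variables occur in \<open>t\<close>, so infinite families of
  arguments are the same as finite tuples.
\<close>

definition term_condition ::
  "('f \<Rightarrow> nat) \<Rightarrow> ('f, 'a) ualg \<Rightarrow> 'a rel \<Rightarrow> 'a rel \<Rightarrow> 'a rel \<Rightarrow> bool" where
  "term_condition ar A \<alpha> \<beta> \<delta> \<longleftrightarrow>
     (\<forall>(t :: ('f, nat + nat) trm) a b u v.
        wf_trm ar t \<longrightarrow> (\<forall>i. (a i, b i) \<in> \<alpha>) \<longrightarrow> (\<forall>j. (u j, v j) \<in> \<beta>) \<longrightarrow>
        (eval_trm A (case_sum a u) t, eval_trm A (case_sum a v) t) \<in> \<delta> \<longrightarrow>
        (eval_trm A (case_sum b u) t, eval_trm A (case_sum b v) t) \<in> \<delta>)"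

definition commutator ::
  "('f \<Rightarrow> nat) \<Rightarrow> ('f, 'a) ualg \<Rightarrow> 'a rel \<Rightarrow> 'a rel \<Rightarrow> 'a rel" where
  "commutator ar A \<alpha> \<beta> = \<Inter>{\<delta> \<in> congruences ar A. term_condition ar A \<alpha> \<beta> \<delta>}"

definition derived_cong :: "('f \<Rightarrow> nat) \<Rightarrow> ('f, 'a) ualg \<Rightarrow> 'a rel" where
  "derived_cong ar A = commutator ar A (greatest_cong A) (greatest_cong A)"

definition abelian_ualg :: "('f \<Rightarrow> nat) \<Rightarrow> ('f, 'a) ualg \<Rightarrow> bool" where
  "abelian_ualg ar A \<longleftrightarrow> derived_cong ar A = least_cong A"

subsection \<open>Varieties\<close>

text \<open>
  A variety \<open>\<U>\<close> is the class of models of a set \<open>E\<close> of identities in countably many variables.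
\<close>

definition identities :: "('f \<Rightarrow> nat) \<Rightarrow> (('f, nat) trm \<times> ('f, nat) trm) set \<Rightarrow> bool" where
  "identities ar E \<longleftrightarrow> (\<forall>(s, t)\<in>E. wf_trm ar s \<and> wf_trm ar t)"

definition in_variety ::
  "('f \<Rightarrow> nat) \<Rightarrow> (('f, nat) trm \<times> ('f, nat) trm) set \<Rightarrow> ('f, 'a) ualg \<Rightarrow> bool" where
  "in_variety ar E A \<longleftrightarrow> ualgebra ar A \<and> (\<forall>e\<in>E. satisfies A e)"

text \<open>
  A definition cannot quantify over algebras on all types. The following two therefore refer to
  the members of the variety whose elements are sets of terms; by the lemmas
  \<open>identities_of_variety_satisfied\<close> and \<open>difference_term_all_types\<close> below, what they say then
  holds for the members of the variety on every type.
\<close>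

definition identities_of_variety ::
  "('f \<Rightarrow> nat) \<Rightarrow> (('f, nat) trm \<times> ('f, nat) trm) set \<Rightarrow> (('f, nat) trm \<times> ('f, nat) trm) set" where
  "identities_of_variety ar E = {(s, t). wf_trm ar s \<and> wf_trm ar t \<and>
     (\<forall>A :: ('f, ('f, nat) trm set) ualg. in_variety ar E A \<longrightarrow> satisfies A (s, t))}"

definition difference_operation ::
  "('f \<Rightarrow> nat) \<Rightarrow> ('f, 'a) ualg \<Rightarrow> 'f \<Rightarrow> bool" where
  "difference_operation ar A m \<longleftrightarrow>
     (\<forall>x\<in>carrier A. \<forall>y\<in>carrier A. oper A m [x, x, y] = y) \<and>
     (\<forall>\<alpha>\<in>congruences ar A. \<forall>(x, y)\<in>\<alpha>. (x, oper A m [x, y, y]) \<in> commutator ar A \<alpha> \<alpha>)"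

definition difference_term ::
  "('f \<Rightarrow> nat) \<Rightarrow> (('f, nat) trm \<times> ('f, nat) trm) set \<Rightarrow> 'f \<Rightarrow> bool" where
  "difference_term ar E m \<longleftrightarrow> ar m = 3 \<and>
     (\<forall>A :: ('f, ('f, nat) trm set) ualg. in_variety ar E A \<longrightarrow> difference_operation ar A m)"

lemma eval_trm_closed:
  assumes "ualgebra ar A" "wf_trm ar t" "\<And>x. v x \<in> carrier A"
  shows "eval_trm A v t \<in> carrier A"
  using assms(2)
proof (induction t)
  case (App f ts)
  then have "map (eval_trm A v) ts \<in> tuples (carrier A) (ar f)"
    by (auto simp: tuples_def list_all_iff)
  then show ?case using assms(1) by (auto simp: ualgebra_def)
qed (use assms in auto)

lemma eval_trm_hom:
  assumes "ualgebra ar A" "\<phi> \<in> ua_hom ar A B" "wf_trm ar t" "\<And>x. v x \<in> carrier A"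
  shows "\<phi> (eval_trm A v t) = eval_trm B (\<lambda>x. \<phi> (v x)) t"
  using assms(3)
proof (induction t)
  case (App f ts)
  have "map (eval_trm A v) ts \<in> tuples (carrier A) (ar f)"
    using App.prems eval_trm_closed[where v = v, OF assms(1) _ assms(4)]
    by (auto simp: tuples_def list_all_iff)
  then have "\<phi> (eval_trm A v (App f ts)) = oper B f (map \<phi> (map (eval_trm A v) ts))"
    using assms(2) by (auto simp: ua_hom_def)
  moreover have "map \<phi> (map (eval_trm A v) ts) = map (eval_trm B (\<lambda>x. \<phi> (v x))) ts"
    using App by (auto simp: list_all_iff)
  ultimately show ?case by (simp del: map_map)
qed (use assms in auto)

lemma satisfies_embedded:
  assumes C: "ualgebra ar C" and \<phi>: "\<phi> \<in> ua_hom ar C A" "inj_on \<phi> (carrier C)"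
    and wf: "wf_trm ar s" "wf_trm ar t" and A: "satisfies A (s, t)"
  shows "satisfies C (s, t)"
proof -
  have "eval_trm C v s = eval_trm C v t" if v: "v \<in> UNIV \<rightarrow> carrier C" for v
  proof -
    have v': "v x \<in> carrier C" for x using v by auto
    have "(\<lambda>x. \<phi> (v x)) \<in> UNIV \<rightarrow> carrier A" using \<phi>(1) v' by (auto simp: ua_hom_def)
    then have "\<phi> (eval_trm C v s) = \<phi> (eval_trm C v t)"
      using A eval_trm_hom[OF C \<phi>(1) wf(1), of v] eval_trm_hom[OF C \<phi>(1) wf(2), of v] v'
      by (auto simp: satisfies_def)
    then show ?thesis
      using \<phi>(2) eval_trm_closed[OF C] wf v' by (meson inj_onD)
  qed
  then show ?thesis by (auto simp: satisfies_def)
qed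

lemma in_variety_embedded:
  assumes "identities ar E" "ualgebra ar C" "\<phi> \<in> ua_hom ar C A" "inj_on \<phi> (carrier C)"
    "in_variety ar E A"
  shows "in_variety ar E C"
proof -
  have "satisfies C (s, t)" if "(s, t) \<in> E" for s t
    by (rule satisfies_embedded[OF assms(2-4)])
      (use that assms(1,5) in \<open>auto simp: in_variety_def identities_def\<close>)
  then show ?thesis using assms(2) by (auto simp: in_variety_def)
qed

definition pull_rel :: "('f, 'c) ualg \<Rightarrow> ('c \<Rightarrow> 'a) \<Rightarrow> 'a rel \<Rightarrow> 'c rel" where
  "pull_rel C \<phi> \<alpha> = {(x, y) \<in> carrier C \<times> carrier C. (\<phi> x, \<phi> y) \<in> \<alpha>}"

lemma pull_rel_congruence:
  assumes C: "ualgebra ar C" and \<phi>: "\<phi> \<in> ua_hom ar C A" and \<alpha>: "\<alpha> \<in> congruences ar A"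
  shows "pull_rel C \<phi> \<alpha> \<in> congruences ar C"
proof -
  have eq: "equiv (carrier A) \<alpha>" and
    cong: "\<And>f xs ys. xs \<in> tuples (carrier A) (ar f) \<Longrightarrow> ys \<in> tuples (carrier A) (ar f) \<Longrightarrow>
      list_all2 (\<lambda>x y. (x, y) \<in> \<alpha>) xs ys \<Longrightarrow> (oper A f xs, oper A f ys) \<in> \<alpha>"
    using \<alpha> by (auto simp: congruences_def)
  have cl: "\<phi> x \<in> carrier A" if "x \<in> carrier C" for x using \<phi> that by (auto simp: ua_hom_def)
  have "equiv (carrier C) (pull_rel C \<phi> \<alpha>)"
  proof (rule equivI)
    show "refl_on (carrier C) (pull_rel C \<phi> \<alpha>)"
      using eq cl by (auto simp: pull_rel_def refl_on_def equiv_def)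
    show "sym (pull_rel C \<phi> \<alpha>)"
      using eq by (auto simp: pull_rel_def equiv_def sym_def)
    show "trans (pull_rel C \<phi> \<alpha>)"
      using eq unfolding pull_rel_def equiv_def trans_def by blast
  qed (auto simp: pull_rel_def)
  moreover have "(oper C f xs, oper C f ys) \<in> pull_rel C \<phi> \<alpha>"
    if xs: "xs \<in> tuples (carrier C) (ar f)" and ys: "ys \<in> tuples (carrier C) (ar f)"
      and xy: "list_all2 (\<lambda>x y. (x, y) \<in> pull_rel C \<phi> \<alpha>) xs ys" for f xs ys
  proof -
    have "map \<phi> xs \<in> tuples (carrier A) (ar f)" "map \<phi> ys \<in> tuples (carrier A) (ar f)"
      using xs ys cl by (auto simp: tuples_def)
    moreover have "list_all2 (\<lambda>x y. (x, y) \<in> \<alpha>) (map \<phi> xs) (map \<phi> ys)"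
      using xy by (auto simp: list_all2_conv_all_nth pull_rel_def)
    ultimately have "(oper A f (map \<phi> xs), oper A f (map \<phi> ys)) \<in> \<alpha>" by (rule cong)
    moreover have "oper C f xs \<in> carrier C" "oper C f ys \<in> carrier C"
      using C xs ys by (auto simp: ualgebra_def)
    ultimately show ?thesis using \<phi> xs ys by (auto simp: pull_rel_def ua_hom_def)
  qed
  ultimately show ?thesis by (auto simp: congruences_def)
qed

lemma pull_rel_commutator:
  assumes C: "ualgebra ar C" and \<phi>: "\<phi> \<in> ua_hom ar C A"
    and xy: "(x, y) \<in> commutator ar C (pull_rel C \<phi> \<alpha>) (pull_rel C \<phi> \<beta>)"
  shows "(\<phi> x, \<phi> y) \<in> commutator ar A \<alpha> \<beta>"
proof -
  have "(\<phi> x, \<phi> y) \<in> \<delta>" if \<delta>: "\<delta> \<in> congruences ar A" and tc: "term_condition ar A \<alpha> \<beta> \<delta>" for \<delta>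
  proof -
    have "term_condition ar C (pull_rel C \<phi> \<alpha>) (pull_rel C \<phi> \<beta>) (pull_rel C \<phi> \<delta>)"
      unfolding term_condition_def
    proof (intro allI impI)
      fix t :: "('a, nat + nat) trm" and a b u v
      assume wf: "wf_trm ar t"
        and ab: "\<forall>i. (a i, b i) \<in> pull_rel C \<phi> \<alpha>" and uv: "\<forall>j. (u j, v j) \<in> pull_rel C \<phi> \<beta>"
        and au: "(eval_trm C (case_sum a u) t, eval_trm C (case_sum a v) t) \<in> pull_rel C \<phi> \<delta>"
      have cl: "a i \<in> carrier C" "b i \<in> carrier C" "u i \<in> carrier C" "v i \<in> carrier C" for i
        using ab uv by (auto simp: pull_rel_def)
      have ev: "eval_trm C (case_sum p q) t \<in> carrier C"
          "\<phi> (eval_trm C (case_sum p q) t) = eval_trm A (case_sum (\<lambda>i. \<phi> (p i)) (\<lambda>i. \<phi> (q i))) t"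
        if "\<And>i. p i \<in> carrier C" "\<And>i. q i \<in> carrier C" for p q
      proof -
        have w: "case_sum p q z \<in> carrier C" for z using that by (cases z) auto
        then show "eval_trm C (case_sum p q) t \<in> carrier C" by (rule eval_trm_closed[OF C wf])
        have "(\<lambda>z. \<phi> (case_sum p q z)) = case_sum (\<lambda>i. \<phi> (p i)) (\<lambda>i. \<phi> (q i))"
          by (auto split: sum.split)
        then show "\<phi> (eval_trm C (case_sum p q) t) =
            eval_trm A (case_sum (\<lambda>i. \<phi> (p i)) (\<lambda>i. \<phi> (q i))) t"
          using eval_trm_hom[OF C \<phi> wf w] by simp
      qed
      have "(eval_trm A (case_sum (\<lambda>i. \<phi> (b i)) (\<lambda>i. \<phi> (u i))) t,
             eval_trm A (case_sum (\<lambda>i. \<phi> (b i)) (\<lambda>i. \<phi> (v i))) t) \<in> \<delta>"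
        by (rule tc[unfolded term_condition_def, rule_format, where a = "\<lambda>i. \<phi> (a i)"])
          (use wf ab uv au ev cl in \<open>auto simp: pull_rel_def\<close>)
      then show "(eval_trm C (case_sum b u) t, eval_trm C (case_sum b v) t) \<in> pull_rel C \<phi> \<delta>"
        using ev cl by (auto simp: pull_rel_def)
    qed
    then have "(x, y) \<in> pull_rel C \<phi> \<delta>"
      using xy pull_rel_congruence[OF C \<phi> \<delta>] by (auto simp: commutator_def)
    then show ?thesis by (auto simp: pull_rel_def)
  qed
  then show ?thesis by (auto simp: commutator_def)
qed

lemma generated_copy:
  fixes A :: "('f, 'a) ualg" and v :: "nat \<Rightarrow> 'a"
  assumes A: "ualgebra ar A" and v: "\<And>i. v i \<in> carrier A"
  obtains C :: "('f, ('f, nat) trm set) ualg" and \<phi>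
  where "ualgebra ar C" "\<phi> \<in> ua_hom ar C A" "inj_on \<phi> (carrier C)" "range v \<subseteq> \<phi> ` carrier C"
proof -
  define S where "S = eval_trm A v ` {t. wf_trm ar t}"
  define g where "g a = {t. wf_trm ar t \<and> eval_trm A v t = a}" for a
  define \<phi> where "\<phi> = inv_into S g"
  define C where "C = \<lparr>carrier = g ` S, oper = (\<lambda>f xs. g (oper A f (map \<phi> xs)))\<rparr>"
  have g: "inj_on g S" unfolding inj_on_def S_def g_def by blast
  have \<phi>g: "\<phi> (g a) = a" if "a \<in> S" for a using g that by (simp add: \<phi>_def)
  have S: "S \<subseteq> carrier A" using eval_trm_closed[OF A] v by (auto simp: S_def)
  have closed: "oper A f xs \<in> S" if "xs \<in> tuples S (ar f)" for f xs
  proof -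
    have "\<forall>a\<in>set xs. \<exists>t. wf_trm ar t \<and> eval_trm A v t = a"
      using that by (auto simp: tuples_def S_def)
    then obtain h where h: "\<forall>a\<in>set xs. wf_trm ar (h a) \<and> eval_trm A v (h a) = a" by metis
    then have "map (eval_trm A v) (map h xs) = xs" by (induction xs) auto
    then have "eval_trm A v (App f (map h xs)) = oper A f xs" by simp
    moreover have "wf_trm ar (App f (map h xs))"
      using h that by (auto simp: tuples_def list_all_iff)
    ultimately show ?thesis unfolding S_def by (metis (mono_tags, lifting) image_eqI mem_Collect_eq)
  qed
  have vS: "v i \<in> S" for i unfolding S_def by (rule image_eqI[of _ _ "Var i"]) auto
  have \<phi>C: "map \<phi> xs \<in> tuples S n" if "xs \<in> tuples (carrier C) n" for xs n
    using that \<phi>g by (fastforce simp: tuples_def C_def)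
  show ?thesis
  proof (rule that)
    show "ualgebra ar C" using vS closed \<phi>C by (auto simp: ualgebra_def C_def)
    show "\<phi> \<in> ua_hom ar C A"
      using \<phi>g S closed \<phi>C by (auto simp: ua_hom_def C_def)
    show "inj_on \<phi> (carrier C)" using \<phi>g by (auto simp: inj_on_def C_def)
    show "range v \<subseteq> \<phi> ` carrier C" using vS \<phi>g by (force simp: C_def image_image)
  qed
qed

lemma identities_of_variety_satisfied:
  fixes A :: "('f, 'a) ualg"
  assumes E: "identities ar E" and A: "in_variety ar E A" and st: "(s, t) \<in> identities_of_variety ar E"
  shows "satisfies A (s, t)"
proof -
  have alg: "ualgebra ar A" using A by (simp add: in_variety_def)
  have wf: "wf_trm ar s" "wf_trm ar t" using st by (auto simp: identities_of_variety_def)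
  have "eval_trm A v s = eval_trm A v t" if "v \<in> UNIV \<rightarrow> carrier A" for v
  proof -
    have "v i \<in> carrier A" for i using that by auto
    then obtain C :: "('f, ('f, nat) trm set) ualg" and \<phi> where
      C: "ualgebra ar C" and \<phi>: "\<phi> \<in> ua_hom ar C A" "inj_on \<phi> (carrier C)"
      and im: "range v \<subseteq> \<phi> ` carrier C"
      by (rule generated_copy[OF alg, of v])
    have "satisfies C (s, t)"
      using in_variety_embedded[OF E C \<phi> A] st by (auto simp: identities_of_variety_def)
    moreover have "\<forall>i. \<exists>z. z \<in> carrier C \<and> \<phi> z = v i"
    proof
      fix i
      have "v i \<in> \<phi> ` carrier C" using im by auto
      then show "\<exists>z. z \<in> carrier C \<and> \<phi> z = v i" by auto
    qed
    then obtain w where w: "\<And>i. w i \<in> carrier C" "\<And>i. \<phi> (w i) = v i" by metis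
    moreover from w have "w \<in> UNIV \<rightarrow> carrier C" by auto
    ultimately have "eval_trm C w s = eval_trm C w t" by (auto simp: satisfies_def)
    then show ?thesis
      using eval_trm_hom[where v = w, OF C \<phi>(1) wf(1) w(1)]
        eval_trm_hom[where v = w, OF C \<phi>(1) wf(2) w(1)] w(2) by simp
  qed
  then show ?thesis by (auto simp: satisfies_def)
qed

lemma difference_term_all_types:
  fixes A :: "('f, 'a) ualg"
  assumes E: "identities ar E" and m: "difference_term ar E m" and A: "in_variety ar E A"
  shows "difference_operation ar A m"
proof -
  have alg: "ualgebra ar A" using A by (simp add: in_variety_def)
  have ar: "ar m = 3" using m by (simp add: difference_term_def)
  have key: "\<exists>(C :: ('f, ('f, nat) trm set) ualg) \<phi> x' y'. ualgebra ar C \<and> \<phi> \<in> ua_hom ar C A \<and>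
      difference_operation ar C m \<and> x' \<in> carrier C \<and> y' \<in> carrier C \<and> \<phi> x' = x \<and> \<phi> y' = y \<and>
      oper A m [x, x, y] = \<phi> (oper C m [x', x', y']) \<and>
      oper A m [x, y, y] = \<phi> (oper C m [x', y', y'])"
    if x: "x \<in> carrier A" and y: "y \<in> carrier A" for x y
  proof -
    define v :: "nat \<Rightarrow> 'a" where "v i = (if i = 0 then x else y)" for i
    have "v i \<in> carrier A" for i using x y by (simp add: v_def)
    then obtain C :: "('f, ('f, nat) trm set) ualg" and \<phi> where
      C: "ualgebra ar C" and \<phi>: "\<phi> \<in> ua_hom ar C A" "inj_on \<phi> (carrier C)"
      and im: "range v \<subseteq> \<phi> ` carrier C"
      by (rule generated_copy[OF alg, of v])
    have "v 0 \<in> \<phi> ` carrier C" "v 1 \<in> \<phi> ` carrier C" using im by auto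
    then obtain x' y' where x': "x' \<in> carrier C" "\<phi> x' = x" and y': "y' \<in> carrier C" "\<phi> y' = y"
      by (auto simp: v_def)
    have "difference_operation ar C m"
      using m in_variety_embedded[OF E C \<phi> A] by (simp add: difference_term_def)
    moreover have "[x', x', y'] \<in> tuples (carrier C) (ar m)" "[x', y', y'] \<in> tuples (carrier C) (ar m)"
      using x' y' ar by (auto simp: tuples_def)
    then have "\<phi> (oper C m [x', x', y']) = oper A m (map \<phi> [x', x', y'])"
      "\<phi> (oper C m [x', y', y']) = oper A m (map \<phi> [x', y', y'])"
      using \<phi>(1) unfolding ua_hom_def by blast+
    then have "\<phi> (oper C m [x', x', y']) = oper A m [x, x, y]"
      "\<phi> (oper C m [x', y', y']) = oper A m [x, y, y]"
      using x' y' by simp_all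
    ultimately show ?thesis using C \<phi>(1) x' y' by (intro exI[of _ C] exI[of _ \<phi>] exI[of _ x'] exI[of _ y']) simp
  qed
  have "oper A m [x, x, y] = y" if "x \<in> carrier A" "y \<in> carrier A" for x y
  proof -
    from key[OF that] obtain C :: "('f, ('f, nat) trm set) ualg" and \<phi> x' y' where
      "difference_operation ar C m" "x' \<in> carrier C" "y' \<in> carrier C" "\<phi> y' = y"
      "oper A m [x, x, y] = \<phi> (oper C m [x', x', y'])" by blast
    then show ?thesis by (simp add: difference_operation_def)
  qed
  moreover have "(x, oper A m [x, y, y]) \<in> commutator ar A \<alpha> \<alpha>"
    if \<alpha>: "\<alpha> \<in> congruences ar A" and xy: "(x, y) \<in> \<alpha>" for \<alpha> x y
  proof -
    have "x \<in> carrier A" "y \<in> carrier A" using \<alpha> xy by (auto simp: congruences_def equiv_def)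
    from key[OF this] obtain C :: "('f, ('f, nat) trm set) ualg" and \<phi> x' y' where
      C: "ualgebra ar C" and \<phi>: "\<phi> \<in> ua_hom ar C A" and d: "difference_operation ar C m"
      and x': "x' \<in> carrier C" "\<phi> x' = x" and y': "y' \<in> carrier C" "\<phi> y' = y"
      and o: "oper A m [x, y, y] = \<phi> (oper C m [x', y', y'])" by blast
    have "(x', y') \<in> pull_rel C \<phi> \<alpha>" using x' y' xy by (auto simp: pull_rel_def)
    then have "(x', oper C m [x', y', y']) \<in> commutator ar C (pull_rel C \<phi> \<alpha>) (pull_rel C \<phi> \<alpha>)"
      using d pull_rel_congruence[OF C \<phi> \<alpha>] by (auto simp: difference_operation_def)
    then show ?thesis using pull_rel_commutator[OF C \<phi>] x' o by metis
  qed
  ultimately show ?thesis by (auto simp: difference_operation_def)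
qed

section \<open>Central data, extensions and cohomology\<close>

text \<open>\<^const>\<open>module\<close> requires a commutative ring of scalars.\<close>

locale unital_module = R?: ring R + M?: abelian_group M
  for R (structure) and M :: "('r, 'b, 'e) module_scheme" (structure) +
  assumes smult_closed [simp, intro]:
      "\<lbrakk>a \<in> carrier R; x \<in> carrier M\<rbrakk> \<Longrightarrow> a \<odot>\<^bsub>M\<^esub> x \<in> carrier M"
    and smult_l_distr:
      "\<lbrakk>a \<in> carrier R; b \<in> carrier R; x \<in> carrier M\<rbrakk> \<Longrightarrow>
       (a \<oplus>\<^bsub>R\<^esub> b) \<odot>\<^bsub>M\<^esub> x = a \<odot>\<^bsub>M\<^esub> x \<oplus>\<^bsub>M\<^esub> b \<odot>\<^bsub>M\<^esub> x"
    and smult_r_distr: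
      "\<lbrakk>a \<in> carrier R; x \<in> carrier M; y \<in> carrier M\<rbrakk> \<Longrightarrow>
       a \<odot>\<^bsub>M\<^esub> (x \<oplus>\<^bsub>M\<^esub> y) = a \<odot>\<^bsub>M\<^esub> x \<oplus>\<^bsub>M\<^esub> a \<odot>\<^bsub>M\<^esub> y"
    and smult_assoc1:
      "\<lbrakk>a \<in> carrier R; b \<in> carrier R; x \<in> carrier M\<rbrakk> \<Longrightarrow>
       (a \<otimes>\<^bsub>R\<^esub> b) \<odot>\<^bsub>M\<^esub> x = a \<odot>\<^bsub>M\<^esub> (b \<odot>\<^bsub>M\<^esub> x)"
    and smult_one [simp]:
      "x \<in> carrier M \<Longrightarrow> \<one>\<^bsub>R\<^esub> \<odot>\<^bsub>M\<^esub> x = x"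

text \<open>
  In the following, \<open>M\<close> is the module structure and \<open>B\<close> the \<open>\<tau>\<close>-algebra structure on the universe of
  a kernel algebra.
\<close>

definition kernel_algebra ::
  "('f \<Rightarrow> nat) \<Rightarrow> 'f \<Rightarrow> ('r, 's) ring_scheme \<Rightarrow> ('r, 'b, 'e) module_scheme \<Rightarrow> ('f, 'b) ualg \<Rightarrow> bool"
where
  "kernel_algebra ar m R M B \<longleftrightarrow>
     unital_module R M \<and> carrier B = carrier M \<and>
     (\<forall>f. \<exists>r \<in> {..<ar f} \<rightarrow> carrier R. \<forall>xs\<in>tuples (carrier M) (ar f).
        oper B f xs = (\<Oplus>\<^bsub>M\<^esub>i\<in>{..<ar f}. r i \<odot>\<^bsub>M\<^esub> xs ! i)) \<and>
     (\<forall>x\<in>carrier M. \<forall>y\<in>carrier M. \<forall>z\<in>carrier M.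
        oper B m [x, y, z] = x \<ominus>\<^bsub>M\<^esub> y \<oplus>\<^bsub>M\<^esub> z)"

definition central_datum ::
  "('f \<Rightarrow> nat) \<Rightarrow> (('f, nat) trm \<times> ('f, nat) trm) set \<Rightarrow> 'f \<Rightarrow> ('r, 's) ring_scheme \<Rightarrow>
   ('r, 'b, 'e) module_scheme \<Rightarrow> ('f, 'b) ualg \<Rightarrow> ('f, 'q) ualg \<Rightarrow> bool" where
  "central_datum ar E m R M B Q \<longleftrightarrow>
     kernel_algebra ar m R M B \<and> in_variety ar E B \<and> in_variety ar E Q"

type_synonym ('f, 'q, 'b) cochain = "'f \<Rightarrow> 'q list \<Rightarrow> 'b"

text \<open>
  Cocycles are \<^const>\<open>extensional\<close> on tuples, so that two of them are equal iff they have the same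
  values there.
\<close>

definition cocycles ::
  "('f \<Rightarrow> nat) \<Rightarrow> ('r, 'b, 'e) module_scheme \<Rightarrow> ('f, 'q) ualg \<Rightarrow> ('f, 'q, 'b) cochain set" where
  "cocycles ar M Q = {T. \<forall>f. T f \<in> tuples (carrier Q) (ar f) \<rightarrow>\<^sub>E carrier M}"

definition twisted_product ::
  "('r, 'b, 'e) module_scheme \<Rightarrow> ('f, 'b) ualg \<Rightarrow> ('f, 'q, 'b) cochain \<Rightarrow> ('f, 'q) ualg \<Rightarrow>
   ('f, 'b \<times> 'q) ualg" where
  "twisted_product M B T Q =
     \<lparr>carrier = carrier B \<times> carrier Q,
      oper = (\<lambda>f xs. (oper B f (map fst xs) \<oplus>\<^bsub>M\<^esub> T f (map snd xs), oper Q f (map snd xs)))\<rparr>"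

text \<open>\<open>trm_cocycle M B T Q v t\<close> is the value of \<open>t\<^sup>\<partial>\<^sup>,\<^sup>T\<close> at the evaluation \<open>v\<close> of the variables in \<open>Q\<close>.\<close>

primrec trm_cocycle ::
  "('r, 'b, 'e) module_scheme \<Rightarrow> ('f, 'b) ualg \<Rightarrow> ('f, 'q, 'b) cochain \<Rightarrow> ('f, 'q) ualg \<Rightarrow>
   ('x \<Rightarrow> 'q) \<Rightarrow> ('f, 'x) trm \<Rightarrow> 'b" where
  "trm_cocycle M B T Q v (Var x) = \<zero>\<^bsub>M\<^esub>"
| "trm_cocycle M B T Q v (App f ts) =
     oper B f (map (trm_cocycle M B T Q v) ts) \<oplus>\<^bsub>M\<^esub> T f (map (eval_trm Q v) ts)"

definition compatible ::
  "('f \<Rightarrow> nat) \<Rightarrow> (('f, nat) trm \<times> ('f, nat) trm) set \<Rightarrow> ('r, 'b, 'e) module_scheme \<Rightarrow>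
   ('f, 'b) ualg \<Rightarrow> ('f, 'q) ualg \<Rightarrow> ('f, 'q, 'b) cochain \<Rightarrow> bool" where
  "compatible ar E M B Q T \<longleftrightarrow>
     (\<forall>(s, t)\<in>identities_of_variety ar E. \<forall>v \<in> UNIV \<rightarrow> carrier Q.
        trm_cocycle M B T Q v s = trm_cocycle M B T Q v t)"

definition compatible_cocycles ::
  "('f \<Rightarrow> nat) \<Rightarrow> (('f, nat) trm \<times> ('f, nat) trm) set \<Rightarrow> ('r, 'b, 'e) module_scheme \<Rightarrow>
   ('f, 'b) ualg \<Rightarrow> ('f, 'q) ualg \<Rightarrow> ('f, 'q, 'b) cochain monoid" where
  "compatible_cocycles ar E M B Q =
     \<lparr>carrier = {T \<in> cocycles ar M Q. compatible ar E M B Q T},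
      mult = (\<lambda>S T f. \<lambda>qs\<in>tuples (carrier Q) (ar f). S f qs \<oplus>\<^bsub>M\<^esub> T f qs),
      one = (\<lambda>f. \<lambda>qs\<in>tuples (carrier Q) (ar f). \<zero>\<^bsub>M\<^esub>)\<rparr>"

definition coboundaries ::
  "('f \<Rightarrow> nat) \<Rightarrow> ('r, 'b, 'e) module_scheme \<Rightarrow> ('f, 'b) ualg \<Rightarrow> ('f, 'q) ualg \<Rightarrow>
   ('f, 'q, 'b) cochain set" where
  "coboundaries ar M B Q =
     {(\<lambda>f. \<lambda>qs\<in>tuples (carrier Q) (ar f). oper B f (map h qs) \<ominus>\<^bsub>M\<^esub> h (oper Q f qs)) | h.
        h \<in> carrier Q \<rightarrow> carrier M}"

definition H2 ::
  "('f \<Rightarrow> nat) \<Rightarrow> (('f, nat) trm \<times> ('f, nat) trm) set \<Rightarrow> ('r, 'b, 'e) module_scheme \<Rightarrow>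
   ('f, 'b) ualg \<Rightarrow> ('f, 'q) ualg \<Rightarrow> ('f, 'q, 'b) cochain set monoid" where
  "H2 ar E M B Q = compatible_cocycles ar E M B Q Mod coboundaries ar M B Q"

definition coh_class ::
  "('f \<Rightarrow> nat) \<Rightarrow> (('f, nat) trm \<times> ('f, nat) trm) set \<Rightarrow> ('r, 'b, 'e) module_scheme \<Rightarrow>
   ('f, 'b) ualg \<Rightarrow> ('f, 'q) ualg \<Rightarrow> ('f, 'q, 'b) cochain \<Rightarrow> ('f, 'q, 'b) cochain set" where
  "coh_class ar E M B Q T = coboundaries ar M B Q #>\<^bsub>compatible_cocycles ar E M B Q\<^esub> T"

definition Ext ::
  "('f \<Rightarrow> nat) \<Rightarrow> (('f, nat) trm \<times> ('f, nat) trm) set \<Rightarrow> ('r, 'b, 'e) module_scheme \<Rightarrow>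
   ('f, 'b) ualg \<Rightarrow> ('f, 'p) ualg \<Rightarrow> ('f, 'p, 'b) cochain set set" where
  "Ext ar E M B P =
     {\<xi> \<in> carrier (H2 ar E M B P). \<exists>S\<in>carrier (compatible_cocycles ar E M B P).
        \<xi> = coh_class ar E M B P S \<and> abelian_ualg ar (twisted_product M B S P)}"

definition pull_cocycle ::
  "('f \<Rightarrow> nat) \<Rightarrow> ('f, 'q) ualg \<Rightarrow> ('q \<Rightarrow> 'p) \<Rightarrow> ('f, 'p, 'b) cochain \<Rightarrow> ('f, 'q, 'b) cochain" where
  "pull_cocycle ar Q \<pi> S = (\<lambda>f. \<lambda>qs\<in>tuples (carrier Q) (ar f). S f (map \<pi> qs))"

text \<open>The class \<open>[S \<circ> \<pi>]\<close> is the same for all representatives \<open>S\<close> of \<open>\<xi>\<close>.\<close>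

definition inflation ::
  "('f \<Rightarrow> nat) \<Rightarrow> (('f, nat) trm \<times> ('f, nat) trm) set \<Rightarrow> ('r, 'b, 'e) module_scheme \<Rightarrow>
   ('f, 'b) ualg \<Rightarrow> ('f, 'q) ualg \<Rightarrow> ('q \<Rightarrow> 'p) \<Rightarrow>
   ('f, 'p, 'b) cochain set \<Rightarrow> ('f, 'q, 'b) cochain set" where
  "inflation ar E M B Q \<pi> \<xi> = the_elem ((\<lambda>S. coh_class ar E M B Q (pull_cocycle ar Q \<pi> S)) ` \<xi>)"

definition central_extension ::
  "('f \<Rightarrow> nat) \<Rightarrow> ('f, 'a) ualg \<Rightarrow> ('f, 'q) ualg \<Rightarrow> ('a \<Rightarrow> 'q) \<Rightarrow> bool" where
  "central_extension ar A Q \<rho> \<longleftrightarrow>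
     \<rho> \<in> ua_hom ar A Q \<and> \<rho> ` carrier A = carrier Q \<and>
     commutator ar A (ker_cong A \<rho>) (greatest_cong A) = least_cong A"

definition realizes_with_class ::
  "('f \<Rightarrow> nat) \<Rightarrow> (('f, nat) trm \<times> ('f, nat) trm) set \<Rightarrow> ('r, 'b, 'e) module_scheme \<Rightarrow>
   ('f, 'b) ualg \<Rightarrow> ('f, 'q) ualg \<Rightarrow> ('f, 'a) ualg \<Rightarrow> ('a \<Rightarrow> 'q) \<Rightarrow>
   ('f, 'q, 'b) cochain set \<Rightarrow> bool" where
  "realizes_with_class ar E M B Q A \<rho> \<xi> \<longleftrightarrow>
     in_variety ar E A \<and> central_extension ar A Q \<rho> \<and>
     (\<exists>T\<in>carrier (compatible_cocycles ar E M B Q). \<xi> = coh_class ar E M B Q T \<and>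
        (\<exists>\<psi>\<in>ua_iso ar A (twisted_product M B T Q). \<forall>a\<in>carrier A. snd (\<psi> a) = \<rho> a))"

end

theory Submission
  imports Defs
begin

text \<open>
  Let \<open>A\<close> be the twisted product of \<open>B\<close> and \<open>Q\<close>, and \<open>D = [1\<^sub>A, 1\<^sub>A]\<close>. If \<open>T\<close> is inflated from a
  cocycle \<open>S\<close> on \<open>P = Q/[1, 1]\<close> with abelian twisted product, then \<open>A\<close> maps homomorphically to that
  abelian algebra by \<open>(b, q) \<mapsto> (b, \<pi> q)\<close>, so \<open>D\<close> does not relate distinct elements of a fibre over \<open>Q\<close>.

  Conversely, let \<open>D\<close> meet the kernel of the projection trivially. With a difference term, every
  congruence \<open>\<theta> \<supseteq> D\<close> satisfies \<open>C(1, 1; \<theta>)\<close>, so the image of \<open>D\<close> in \<open>Q\<close> is \<open>[1, 1]\<close>, and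
  \<open>D\<close> assigns to every \<open>q\<close> an element \<open>h q\<close> of \<open>B\<close> by which \<open>q\<close> is compared with a representative of its
  class. Subtracting the coboundary of \<open>h\<close> from \<open>T\<close> gives a cocycle that factors through \<open>P\<close>, and the
  resulting twisted product over \<open>P\<close> is the abelian algebra \<open>A/D\<close>.
\<close>

section \<open>Congruences, the term condition and the derived congruence\<close>

lemma congruencesD:
  assumes "\<theta> \<in> congruences ar A"
  shows "equiv (carrier A) \<theta>"
    and "\<lbrakk>(x, y) \<in> \<theta>; (y, z) \<in> \<theta>\<rbrakk> \<Longrightarrow> (x, z) \<in> \<theta>"
    and "(x, y) \<in> \<theta> \<Longrightarrow> (y, x) \<in> \<theta>"
    and "x \<in> carrier A \<Longrightarrow> (x, x) \<in> \<theta>"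
    and "(x, y) \<in> \<theta> \<Longrightarrow> x \<in> carrier A"
    and "(x, y) \<in> \<theta> \<Longrightarrow> y \<in> carrier A"
proof -
  show eq: "equiv (carrier A) \<theta>" using assms by (simp add: congruences_def)
  show "(x, z) \<in> \<theta>" if "(x, y) \<in> \<theta>" "(y, z) \<in> \<theta>" using eq that by (meson equivE transE)
  show "(y, x) \<in> \<theta>" if "(x, y) \<in> \<theta>" using eq that by (meson equivE symE)
  show "(x, x) \<in> \<theta>" if "x \<in> carrier A" using eq that by (meson equivE refl_onD)
  show "x \<in> carrier A" "y \<in> carrier A" if "(x, y) \<in> \<theta>"
    using eq that by (auto simp: equiv_def)
qed

text \<open>Both argument tuples are images of one common list \<open>zs\<close>, so relatedness
  becomes a condition on each element. A typical use takes \<open>zs\<close> to be a list of pairs,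
  with \<open>fst\<close> and \<open>snd\<close> as the two maps.\<close>

lemma congruence_oper_map:
  assumes "\<theta> \<in> congruences ar A" "length zs = ar f" "\<And>z. z \<in> set zs \<Longrightarrow> (p z, q z) \<in> \<theta>"
  shows "(oper A f (map p zs), oper A f (map q zs)) \<in> \<theta>"
proof -
  have "map p zs \<in> tuples (carrier A) (ar f)" "map q zs \<in> tuples (carrier A) (ar f)"
    using assms(2) congruencesD(5,6)[OF assms(1) assms(3)] by (auto simp: tuples_def)
  moreover have "list_all2 (\<lambda>x y. (x, y) \<in> \<theta>) (map p zs) (map q zs)"
    using assms(3) by (auto simp: list_all2_conv_all_nth)
  ultimately show ?thesis using assms(1) by (auto simp: congruences_def)
qed

lemma greatest_cong_congruence:
  "ualgebra ar A \<Longrightarrow> greatest_cong A \<in> congruences ar A"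
  by (auto simp: congruences_def greatest_cong_def ualgebra_def equiv_def refl_on_def sym_def
      trans_def)

lemma least_cong_congruence:
  assumes "ualgebra ar A"
  shows "least_cong A \<in> congruences ar A"
proof -
  have "xs = ys" if "list_all2 (\<lambda>x y. (x, y) \<in> Id_on (carrier A)) xs ys" for xs ys :: "'b list"
    using that by (induction) auto
  then show ?thesis
    using assms
    by (auto simp: congruences_def least_cong_def ualgebra_def equiv_def refl_on_def sym_def
        trans_def)
qed

lemma eval_case_sum_closed:
  assumes "ualgebra ar A" "wf_trm ar t" "\<And>i. a i \<in> carrier A" "\<And>j. u j \<in> carrier A"
  shows "eval_trm A (case_sum a u) t \<in> carrier A"
  by (rule eval_trm_closed[OF assms(1,2)]) (use assms(3,4) in \<open>auto split: sum.split\<close>)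

lemma eval_case_sum_hom:
  assumes "ualgebra ar A" "\<phi> \<in> ua_hom ar A C" "wf_trm ar t"
    "\<And>i. a i \<in> carrier A" "\<And>j. u j \<in> carrier A"
  shows "\<phi> (eval_trm A (case_sum a u) t) = eval_trm C (case_sum (\<phi> \<circ> a) (\<phi> \<circ> u)) t"
proof -
  have "case_sum a u z \<in> carrier A" for z using assms(4,5) by (cases z) auto
  moreover have "(\<lambda>z. \<phi> (case_sum a u z)) = case_sum (\<phi> \<circ> a) (\<phi> \<circ> u)"
    by (auto split: sum.split)
  ultimately show ?thesis using eval_trm_hom[OF assms(1-3), of "case_sum a u"] by simp
qed

text \<open>Renaming variables allows two copies of one term to be used inside a larger term with
  separate first blocks of arguments.\<close>

lemma eval_map_trm: "eval_trm A v (map_trm id g t) = eval_trm A (v \<circ> g) t"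
  by (induction t) (auto intro: arg_cong[where f = "oper A _"])

lemma wf_map_trm: "wf_trm ar (map_trm id g t) = wf_trm ar t"
  by (induction t) (auto simp: list_all_iff)

lemma term_conditionD:
  fixes t :: "('f, nat + nat) trm"
  assumes "term_condition ar A \<alpha> \<beta> \<delta>" "wf_trm ar t" "\<And>i. (a i, b i) \<in> \<alpha>" "\<And>j. (u j, v j) \<in> \<beta>"
    "(eval_trm A (case_sum a u) t, eval_trm A (case_sum a v) t) \<in> \<delta>"
  shows "(eval_trm A (case_sum b u) t, eval_trm A (case_sum b v) t) \<in> \<delta>"
  using assms unfolding term_condition_def by blast

text \<open>A premise that holds in the intersection holds in every member, and so does the
  resulting conclusion. Hence the term condition passes to intersections in its third
  argument.\<close>

lemma commutator_term_condition: "term_condition ar A \<alpha> \<beta> (commutator ar A \<alpha> \<beta>)"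
  unfolding term_condition_def
proof (intro allI impI)
  fix t :: "('a, nat + nat) trm" and a b u v
  assume *: "wf_trm ar t" "\<forall>i. (a i, b i) \<in> \<alpha>" "\<forall>j. (u j, v j) \<in> \<beta>"
    "(eval_trm A (case_sum a u) t, eval_trm A (case_sum a v) t) \<in> commutator ar A \<alpha> \<beta>"
  have "(eval_trm A (case_sum b u) t, eval_trm A (case_sum b v) t) \<in> \<delta>"
    if \<delta>: "\<delta> \<in> congruences ar A" "term_condition ar A \<alpha> \<beta> \<delta>" for \<delta>
    by (rule term_conditionD[OF \<delta>(2), where a = a]) (use * \<delta> in \<open>auto simp: commutator_def\<close>)
  then show "(eval_trm A (case_sum b u) t, eval_trm A (case_sum b v) t) \<in> commutator ar A \<alpha> \<beta>"
    by (auto simp: commutator_def)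
qed

lemma commutator_least:
  "\<lbrakk>\<delta> \<in> congruences ar A; term_condition ar A \<alpha> \<beta> \<delta>\<rbrakk> \<Longrightarrow> commutator ar A \<alpha> \<beta> \<subseteq> \<delta>"
  by (auto simp: commutator_def)

lemma commutator_eq_least_cong:
  assumes "ualgebra ar A" "term_condition ar A \<alpha> \<beta> (least_cong A)"
  shows "commutator ar A \<alpha> \<beta> = least_cong A"
proof
  show "commutator ar A \<alpha> \<beta> \<subseteq> least_cong A"
    by (rule commutator_least[OF least_cong_congruence]) (use assms in auto)
  show "least_cong A \<subseteq> commutator ar A \<alpha> \<beta>"
    using congruencesD(4) by (fastforce simp: commutator_def least_cong_def)
qed

text \<open>The full relation satisfies its own term condition, so the intersection has a member and
  stays inside the carrier; an empty intersection would be the universal relation of the type. The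
  closure properties are inherited from the members.\<close>

lemma derived_cong_congruence:
  assumes A: "ualgebra ar A"
  shows "derived_cong ar A \<in> congruences ar A"
proof -
  let ?K = "{\<delta> \<in> congruences ar A. term_condition ar A (greatest_cong A) (greatest_cong A) \<delta>}"
  have "term_condition ar A (greatest_cong A) (greatest_cong A) (greatest_cong A)"
    unfolding term_condition_def greatest_cong_def
    by (intro allI impI SigmaI eval_case_sum_closed[OF A]) auto
  then have g: "greatest_cong A \<in> ?K" using greatest_cong_congruence[OF A] by simp
  have D: "derived_cong ar A = \<Inter>?K" by (simp add: derived_cong_def commutator_def)
  have mem: "(x, y) \<in> derived_cong ar A \<longleftrightarrow> (\<forall>\<delta>\<in>?K. (x, y) \<in> \<delta>)" for x y
    by (simp add: D)
  have "equiv (carrier A) (derived_cong ar A)"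
  proof (rule equivI)
    show "derived_cong ar A \<subseteq> carrier A \<times> carrier A"
      using g unfolding D by (auto simp: greatest_cong_def)
    show "refl_on (carrier A) (derived_cong ar A)"
      using congruencesD(4) by (fastforce simp: refl_on_def mem)
    show "sym (derived_cong ar A)"
      unfolding sym_def mem by (blast intro: congruencesD(3))
    show "trans (derived_cong ar A)"
      unfolding trans_def mem by (blast intro: congruencesD(2))
  qed
  moreover have "(oper A f xs, oper A f ys) \<in> derived_cong ar A"
    if "xs \<in> tuples (carrier A) (ar f)" "ys \<in> tuples (carrier A) (ar f)"
      "list_all2 (\<lambda>x y. (x, y) \<in> derived_cong ar A) xs ys" for f xs ys
  proof -
    have "list_all2 (\<lambda>x y. (x, y) \<in> \<delta>) xs ys" if "\<delta> \<in> ?K" for \<delta>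
      by (rule list_all2_mono[OF \<open>list_all2 _ xs ys\<close>]) (use that mem in blast)
    then show ?thesis using that unfolding mem by (auto simp: congruences_def)
  qed
  ultimately show ?thesis by (auto simp: congruences_def)
qed

section \<open>Homomorphisms, the difference term and the derived congruence\<close>

text \<open>The full congruence pulls back to the full congruence, so the general fact on pulled
  back commutators applies. The opposite inclusion for images is
  \<open>derived_cong_image\<close>.\<close>

lemma derived_cong_hom:
  assumes "ualgebra ar A" "\<phi> \<in> ua_hom ar A C" "(x, y) \<in> derived_cong ar A"
  shows "(\<phi> x, \<phi> y) \<in> derived_cong ar C"
proof -
  have "pull_rel A \<phi> (greatest_cong C) = greatest_cong A"
    using assms(2) by (auto simp: pull_rel_def greatest_cong_def ua_hom_def)
  then show ?thesis using pull_rel_commutator[OF assms(1,2)] assms(3)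
    by (metis derived_cong_def)
qed

text \<open>The term \<open>m(t(a,u), t(X,Y), t(Z,Y))\<close> in \<open>X, Y, Z\<close> has the value \<open>m(t(a,u), y, y)\<close> at
  \<open>X = Z = b\<close>, which is congruent to \<open>t(a,u)\<close> for both values \<open>u, v\<close> of \<open>Y\<close>. The term condition for
  the derived congruence moves \<open>X\<close> from \<open>b\<close> to \<open>a\<close> and shows that \<open>t(b,u)\<close> and
  \<open>m(t(a,u), t(a,v), t(b,v))\<close> are congruent.\<close>

lemma term_condition_above_derived:
  assumes A: "ualgebra ar A" and ar: "ar m = 3" and m: "difference_operation ar A m"
    and \<theta>: "\<theta> \<in> congruences ar A" "derived_cong ar A \<subseteq> \<theta>"
  shows "term_condition ar A (greatest_cong A) (greatest_cong A) \<theta>"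
  unfolding term_condition_def
proof (intro allI impI)
  fix t :: "('a, nat + nat) trm" and a b u v
  assume t: "wf_trm ar t" and "\<forall>i. (a i, b i) \<in> greatest_cong A" "\<forall>j. (u j, v j) \<in> greatest_cong A"
    and \<theta>a: "(eval_trm A (case_sum a u) t, eval_trm A (case_sum a v) t) \<in> \<theta>"
  then have cl: "a i \<in> carrier A" "b i \<in> carrier A" "u i \<in> carrier A" "v i \<in> carrier A" for i
    by (auto simp: greatest_cong_def)
  define D where "D = derived_cong ar A"
  have D: "D \<in> congruences ar A" unfolding D_def by (rule derived_cong_congruence[OF A])
  have mxx: "oper A m [x, x, y] = y" if "x \<in> carrier A" "y \<in> carrier A" for x y
    using m that by (auto simp: difference_operation_def)
  have mD: "(x, oper A m [x, y, y]) \<in> D" if "x \<in> carrier A" "y \<in> carrier A" for x y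
    using m that greatest_cong_congruence[OF A]
    by (auto simp: difference_operation_def D_def derived_cong_def greatest_cong_def)
  define e where "e p q = eval_trm A (case_sum p q) t" for p q
  have e: "e p q \<in> carrier A" if "\<And>i. p i \<in> carrier A" "\<And>i. q i \<in> carrier A" for p q
    unfolding e_def by (rule eval_case_sum_closed[OF A t]) (use that in auto)
  \<comment> \<open>Layout of the first block: index 0 holds the fixed value t(a,u), odd indices the
    moving arguments \<open>p\<close>, and even indices from 2 on the fixed arguments
    \<open>b\<close>. Both copies of \<open>t\<close> share the second block.\<close>
  define s :: "('a, nat + nat) trm" where
    "s = App m [Var (Inl 0), map_trm id (case_sum (\<lambda>i. Inl (2 * i + 1)) Inr) t,
                             map_trm id (case_sum (\<lambda>i. Inl (2 * i + 2)) Inr) t]"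
  define w where "w p n = (if n = 0 then e a u else if odd n then p (n div 2) else b ((n - 2) div 2))"
    for p and n :: nat
  have s: "wf_trm ar s" using t ar by (simp add: s_def wf_map_trm)
  have es: "eval_trm A (case_sum (w p) q) s = oper A m [e a u, e p q, e b q]" for p q
  proof -
    have "case_sum (w p) q \<circ> case_sum (\<lambda>i. Inl (2 * i + 1)) Inr = case_sum p q"
      "case_sum (w p) q \<circ> case_sum (\<lambda>i. Inl (2 * i + 2)) Inr = case_sum b q"
      by (auto simp: w_def fun_eq_iff split: sum.split)
    then show ?thesis by (simp add: s_def eval_map_trm e_def) (simp add: w_def e_def)
  qed
  have wc: "w p n \<in> carrier A" if "\<And>i. p i \<in> carrier A" for p n
    using that e cl by (simp add: w_def)
  have "(oper A m [e a u, e a u, e b u], oper A m [e a u, e a v, e b v]) \<in> D"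
    unfolding es[symmetric] D_def derived_cong_def
  proof (rule term_conditionD[OF commutator_term_condition s, where a = "w b"], goal_cases)
    case 3
    have "(oper A m [e a u, e b u, e b u], oper A m [e a u, e b v, e b v]) \<in> D"
      by (rule congruencesD(2)[OF D congruencesD(3)[OF D mD] mD]) (use e cl in auto)
    then show ?case unfolding es[symmetric] D_def derived_cong_def .
  qed (use wc cl in \<open>auto simp: greatest_cong_def\<close>)
  then have 1: "(e b u, oper A m [e a u, e a v, e b v]) \<in> \<theta>"
    using mxx e cl \<theta>(2) by (auto simp: D_def)
  have "e a v \<in> carrier A" "e b v \<in> carrier A" using e cl by auto
  \<comment> \<open>So far \<theta> served only as a congruence above \<open>D\<close>. Now the
    premise on \<open>a\<close> replaces the first argument, after which m(x,x,y) = y collapses the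
    right side to \<open>e b v\<close>.\<close>
  then have "(oper A m [e a u, e a v, e b v], oper A m [e a v, e a v, e b v]) \<in> \<theta>"
    using congruence_oper_map[OF \<theta>(1), of "[(e a u, e a v), (e a v, e a v), (e b v, e b v)]" m fst snd]
      \<theta>a ar congruencesD(4)[OF \<theta>(1)] by (auto simp: e_def)
  then have "(e b u, e b v) \<in> \<theta>"
    using 1 mxx e cl congruencesD(2)[OF \<theta>(1)] by metis
  then show "(eval_trm A (case_sum b u) t, eval_trm A (case_sum b v) t) \<in> \<theta>" by (simp add: e_def)
qed

text \<open>The pullback of \<theta> to \<open>A\<close> lies above the derived congruence, so it
  satisfies the term condition by \<open>term_condition_above_derived\<close>. Arguments in
  \<open>C\<close> lift through the surjection, hence \<theta> itself satisfies the term condition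
  and contains the commutator.\<close>

lemma derived_cong_image:
  assumes A: "ualgebra ar A" and ar: "ar m = 3" and m: "difference_operation ar A m"
    and C: "ualgebra ar C" and \<phi>: "\<phi> \<in> ua_hom ar A C" and surj: "\<phi> ` carrier A = carrier C"
    and \<theta>: "\<theta> \<in> congruences ar C" "\<And>x y. (x, y) \<in> derived_cong ar A \<Longrightarrow> (\<phi> x, \<phi> y) \<in> \<theta>"
  shows "derived_cong ar C \<subseteq> \<theta>"
  unfolding derived_cong_def
proof (rule commutator_least[OF \<theta>(1)], unfold term_condition_def, intro allI impI)
  fix t :: "('a, nat + nat) trm" and a b u v
  assume t: "wf_trm ar t" and "\<forall>i. (a i, b i) \<in> greatest_cong C" "\<forall>j. (u j, v j) \<in> greatest_cong C"
    and \<theta>a: "(eval_trm C (case_sum a u) t, eval_trm C (case_sum a v) t) \<in> \<theta>"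
  then have "q i \<in> \<phi> ` carrier A" if "q \<in> {a, b, u, v}" for q i
    using surj that by (auto simp: greatest_cong_def)
  then have "\<exists>p. \<forall>i. p i \<in> carrier A \<and> \<phi> (p i) = q i" if "q \<in> {a, b, u, v}" for q
    using that by (intro choice) (metis imageE)
  then obtain a' b' u' v' where
    lift: "\<phi> \<circ> a' = a" "\<phi> \<circ> b' = b" "\<phi> \<circ> u' = u" "\<phi> \<circ> v' = v" and
    cl: "\<And>i. a' i \<in> carrier A" "\<And>i. b' i \<in> carrier A" "\<And>i. u' i \<in> carrier A" "\<And>i. v' i \<in> carrier A"
    unfolding fun_eq_iff comp_def by (metis insertCI)
  let ?R = "pull_rel A \<phi> \<theta>"
  have R: "?R \<in> congruences ar A" by (rule pull_rel_congruence[OF A \<phi> \<theta>(1)])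
  have D: "derived_cong ar A \<subseteq> ?R"
    using congruencesD(5,6)[OF derived_cong_congruence[OF A]] \<theta>(2) by (auto simp: pull_rel_def)
  note hom = eval_case_sum_hom[OF A \<phi> t]
  have "(eval_trm A (case_sum b' u') t, eval_trm A (case_sum b' v') t) \<in> ?R"
  proof (rule term_conditionD[OF term_condition_above_derived[OF A ar m R D] t, where a = a'],
      goal_cases)
    case 3
    then show ?case
      using \<theta>a lift hom[of a' u'] hom[of a' v'] cl eval_case_sum_closed[OF A t]
      by (auto simp: pull_rel_def)
  qed (use cl in \<open>auto simp: greatest_cong_def\<close>)
  then show "(eval_trm C (case_sum b u) t, eval_trm C (case_sum b v) t) \<in> \<theta>"
    using lift hom[of b' u'] hom[of b' v'] cl by (auto simp: pull_rel_def)
qed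

section \<open>Quotients and homomorphic images\<close>

lemma canonical_hom_eq_iff:
  assumes "\<theta> \<in> congruences ar A" "x \<in> carrier A" "y \<in> carrier A"
  shows "canonical_hom \<theta> x = canonical_hom \<theta> y \<longleftrightarrow> (x, y) \<in> \<theta>"
  using eq_equiv_class_iff[OF congruencesD(1)[OF assms(1)] assms(2,3)] by (simp add: canonical_hom_def)

text \<open>The union in \<open>quotient_ualg\<close> ranges over all lists of representatives. They
  all contribute the same class because \<theta> is a congruence, and \<open>xs\<close> is itself
  such a list, so the union is exactly that class.\<close>

lemma quotient_oper:
  assumes \<theta>: "\<theta> \<in> congruences ar A" and xs: "xs \<in> tuples (carrier A) (ar f)"
  shows "oper (quotient_ualg A \<theta>) f (map (canonical_hom \<theta>) xs) = canonical_hom \<theta> (oper A f xs)"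
proof -
  have L: "ys \<in> listset (map (canonical_hom \<theta>) zs) \<longleftrightarrow> list_all2 (\<lambda>x y. (x, y) \<in> \<theta>) zs ys" for zs ys
    by (induction zs arbitrary: ys) (auto simp: set_Cons_def canonical_hom_def list_all2_Cons1)
  have "\<theta> `` {oper A f ys} = \<theta> `` {oper A f xs}" if "list_all2 (\<lambda>x y. (x, y) \<in> \<theta>) xs ys" for ys
  proof -
    have "ys \<in> tuples (carrier A) (ar f)"
      using that xs congruencesD(6)[OF \<theta>]
      by (fastforce simp: tuples_def list_all2_conv_all_nth in_set_conv_nth)
    then have "(oper A f xs, oper A f ys) \<in> \<theta>" using \<theta> xs that by (auto simp: congruences_def)
    then show ?thesis using equiv_class_eq[OF congruencesD(1)[OF \<theta>]] by metis
  qed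
  moreover have "list_all2 (\<lambda>x y. (x, y) \<in> \<theta>) xs xs"
    using xs congruencesD(4)[OF \<theta>] by (auto simp: tuples_def list_all2_same)
  ultimately have "(\<Union>ys\<in>{ys. list_all2 (\<lambda>x y. (x, y) \<in> \<theta>) xs ys}. \<theta> `` {oper A f ys}) = \<theta> `` {oper A f xs}"
    by blast
  moreover have "listset (map (canonical_hom \<theta>) xs) = {ys. list_all2 (\<lambda>x y. (x, y) \<in> \<theta>) xs ys}"
    using L by blast
  ultimately show ?thesis by (simp add: quotient_ualg_def canonical_hom_def)
qed

lemma quotient_carrier: "carrier (quotient_ualg A \<theta>) = canonical_hom \<theta> ` carrier A"
  by (auto simp: quotient_ualg_def canonical_hom_def quotient_def)

lemma canonical_hom_hom:
  assumes "\<theta> \<in> congruences ar A"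
  shows "canonical_hom \<theta> \<in> ua_hom ar A (quotient_ualg A \<theta>)"
  using quotient_oper[OF assms] by (auto simp: ua_hom_def quotient_carrier)

lemma ualgebra_image:
  assumes A: "ualgebra ar A" and \<phi>: "\<phi> \<in> ua_hom ar A C" and surj: "\<phi> ` carrier A = carrier C"
  shows "ualgebra ar C"
proof -
  have "oper C f ys \<in> carrier C" if "ys \<in> tuples (carrier C) (ar f)" for f ys
  proof -
    have "ys \<in> map \<phi> ` lists (carrier A)"
      using that surj unfolding lists_image[symmetric] by (auto simp: tuples_def)
    then obtain xs where xs: "ys = map \<phi> xs" "set xs \<subseteq> carrier A" by auto
    then have "xs \<in> tuples (carrier A) (ar f)" using that by (auto simp: tuples_def)
    then have "oper A f xs \<in> carrier A" "oper C f ys = \<phi> (oper A f xs)"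
      using A \<phi> xs by (auto simp: ualgebra_def ua_hom_def)
    then show ?thesis using surj by auto
  qed
  then show ?thesis using A surj by (auto simp: ualgebra_def)
qed

text \<open>This is \<open>derived_cong_image\<close> with equality on \<open>C\<close> as the
  target congruence.\<close>

lemma abelian_image:
  assumes A: "ualgebra ar A" and ar: "ar m = 3" and m: "difference_operation ar A m"
    and \<phi>: "\<phi> \<in> ua_hom ar A C" and surj: "\<phi> ` carrier A = carrier C"
    and ker: "\<And>x y. (x, y) \<in> derived_cong ar A \<Longrightarrow> \<phi> x = \<phi> y"
  shows "abelian_ualg ar C"
proof -
  have C: "ualgebra ar C" by (rule ualgebra_image[OF A \<phi> surj])
  have "derived_cong ar C \<subseteq> least_cong C"
    by (rule derived_cong_image[OF A ar m C \<phi> surj least_cong_congruence[OF C]])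
      (use ker congruencesD(5,6)[OF derived_cong_congruence[OF A]] surj in \<open>fastforce simp: least_cong_def\<close>)
  then show ?thesis
    using congruencesD(4)[OF derived_cong_congruence[OF C]]
    by (auto simp: abelian_ualg_def least_cong_def)
qed

section \<open>Algebras with additive operations and their twisted products\<close>

lemma map_tuples:
  "\<lbrakk>xs \<in> tuples X n; \<And>x. x \<in> X \<Longrightarrow> p x \<in> Y\<rbrakk> \<Longrightarrow> map p xs \<in> tuples Y n"
  by (auto simp: tuples_def)

text \<open>Isolates what the computations with cocycles use of a kernel algebra: an abelian group
  on which every operation is additive in its whole argument tuple.
  \<open>kernel_algebra_additive\<close> derives this from the module terms.\<close>

locale additive_ualg = abelian_group M
  for M :: "('r, 'b, 'e) module_scheme" (structure) +
  fixes ar :: "'f \<Rightarrow> nat" and B :: "('f, 'b) ualg"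
  assumes ualgebra_B: "ualgebra ar B"
    and carrier_B: "carrier B = carrier M"
    and oper_add: "\<lbrakk>xs \<in> tuples (carrier M) (ar f); ys \<in> tuples (carrier M) (ar f)\<rbrakk> \<Longrightarrow>
      oper B f (map2 (\<oplus>) xs ys) = oper B f xs \<oplus> oper B f ys"
begin

lemma cancel_right:
  "\<lbrakk>x \<in> carrier M; y \<in> carrier M; z \<in> carrier M\<rbrakk> \<Longrightarrow> x \<oplus> z = y \<oplus> z \<longleftrightarrow> x = y"
  by (rule add.right_cancel)

lemma cancel_left:
  "\<lbrakk>x \<in> carrier M; y \<in> carrier M; z \<in> carrier M\<rbrakk> \<Longrightarrow> z \<oplus> x = z \<oplus> y \<longleftrightarrow> x = y"
  by (simp add: a_comm[of z] cancel_right)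

lemma oper_closed: "xs \<in> tuples (carrier M) (ar f) \<Longrightarrow> oper B f xs \<in> carrier M"
  using ualgebra_B by (simp add: ualgebra_def carrier_B)

lemma oper_map_closed:
  "\<lbrakk>length zs = ar f; \<And>z. z \<in> set zs \<Longrightarrow> p z \<in> carrier M\<rbrakk> \<Longrightarrow> oper B f (map p zs) \<in> carrier M"
  by (rule oper_closed) (auto simp: tuples_def)

lemma oper_map_add:
  assumes "length zs = ar f" "\<And>z. z \<in> set zs \<Longrightarrow> p z \<in> carrier M"
    "\<And>z. z \<in> set zs \<Longrightarrow> q z \<in> carrier M"
  shows "oper B f (map (\<lambda>z. p z \<oplus> q z) zs) = oper B f (map p zs) \<oplus> oper B f (map q zs)"
proof -
  have "map p zs \<in> tuples (carrier M) (ar f)" "map q zs \<in> tuples (carrier M) (ar f)"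
    using assms by (auto simp: tuples_def)
  from oper_add[OF this] show ?thesis by (simp add: map2_map_map)
qed

lemma oper_map_zero:
  assumes "length zs = ar f"
  shows "oper B f (map (\<lambda>z. \<zero>) zs) = \<zero>"
proof -
  have "oper B f (map (\<lambda>z. \<zero>) zs) \<oplus> \<zero> = oper B f (map (\<lambda>z. \<zero>) zs) \<oplus> oper B f (map (\<lambda>z. \<zero>) zs)"
    using oper_map_add[OF assms, of "\<lambda>z. \<zero>" "\<lambda>z. \<zero>"] oper_map_closed[OF assms, of "\<lambda>z. \<zero>"] by simp
  then show ?thesis using oper_map_closed[OF assms, of "\<lambda>z. \<zero>"] by (simp add: cancel_left)
qed

lemma oper_map_neg:
  assumes "length zs = ar f" "\<And>z. z \<in> set zs \<Longrightarrow> p z \<in> carrier M"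
  shows "oper B f (map (\<lambda>z. \<ominus> p z) zs) = \<ominus> oper B f (map p zs)"
proof -
  have "oper B f (map (\<lambda>z. \<ominus> p z) zs) \<oplus> oper B f (map p zs) = oper B f (map (\<lambda>z. \<ominus> p z \<oplus> p z) zs)"
    using oper_map_add[OF assms(1), of "\<lambda>z. \<ominus> p z" p] assms(2) by simp
  also have "\<dots> = oper B f (map (\<lambda>z. \<zero>) zs)"
    using assms(2) by (intro arg_cong[where f = "oper B f"]) (simp add: l_neg)
  finally show ?thesis
    using oper_map_zero[OF assms(1)] oper_map_closed[OF assms(1)] assms(2) minus_equality by force
qed

lemma eval_closed: "\<lbrakk>wf_trm ar t; \<And>x. p x \<in> carrier M\<rbrakk> \<Longrightarrow> eval_trm B p t \<in> carrier M"
  using eval_trm_closed[OF ualgebra_B, of t p] by (simp add: carrier_B)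

lemma eval_add:
  assumes "wf_trm ar t" "\<And>x. p x \<in> carrier M" "\<And>x. q x \<in> carrier M"
  shows "eval_trm B (\<lambda>x. p x \<oplus> q x) t = eval_trm B p t \<oplus> eval_trm B q t"
  using assms(1)
proof (induction t)
  case (App f ts)
  then have "map (eval_trm B (\<lambda>x. p x \<oplus> q x)) ts = map (\<lambda>t. eval_trm B p t \<oplus> eval_trm B q t) ts"
    by (auto simp: list_all_iff)
  moreover have "eval_trm B p t \<in> carrier M" "eval_trm B q t \<in> carrier M" if "t \<in> set ts" for t
    using App.prems that eval_closed[of t] assms(2,3) by (auto simp: list_all_iff)
  ultimately show ?case
    using oper_map_add[of ts f "eval_trm B p" "eval_trm B q"] App.prems by (simp del: map_eq_conv)
qed simp

lemma twisted_carrier [simp]: "carrier (twisted_product M B T Q) = carrier M \<times> carrier Q"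
  by (simp add: twisted_product_def carrier_B)

lemma twisted_oper [simp]:
  "oper (twisted_product M B T Q) f xs =
     (oper B f (map fst xs) \<oplus> T f (map snd xs), oper Q f (map snd xs))"
  by (simp add: twisted_product_def)

lemma cocycle_closed:
  "\<lbrakk>T \<in> cocycles ar M Q; qs \<in> tuples (carrier Q) (ar f)\<rbrakk> \<Longrightarrow> T f qs \<in> carrier M"
  by (auto simp: cocycles_def)

lemma twisted_ualgebra:
  assumes Q: "ualgebra ar Q" and T: "T \<in> cocycles ar M Q"
  shows "ualgebra ar (twisted_product M B T Q)"
proof -
  have "oper (twisted_product M B T Q) f xs \<in> carrier M \<times> carrier Q"
    if "xs \<in> tuples (carrier M \<times> carrier Q) (ar f)" for f xs
  proof -
    have "map fst xs \<in> tuples (carrier M) (ar f)" "map snd xs \<in> tuples (carrier Q) (ar f)"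
      using that by (auto intro: map_tuples)
    then show ?thesis using oper_closed cocycle_closed[OF T] Q by (auto simp: ualgebra_def)
  qed
  then show ?thesis using Q by (auto simp: ualgebra_def)
qed

lemma trm_cocycle_closed:
  assumes Q: "ualgebra ar Q" and T: "T \<in> cocycles ar M Q" and "wf_trm ar t" and v: "\<And>x. v x \<in> carrier Q"
  shows "trm_cocycle M B T Q v t \<in> carrier M"
  using assms(3)
proof (induction t)
  case (App f ts)
  have "map (eval_trm Q v) ts \<in> tuples (carrier Q) (ar f)"
    using App.prems eval_trm_closed[where v = v, OF Q _ v] by (auto simp: tuples_def list_all_iff)
  then show ?case
    using oper_map_closed[of ts f] cocycle_closed[OF T] App by (auto simp: list_all_iff)
qed simp

text \<open>Additivity of the operations of \<open>B\<close> separates, at each symbol, the part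
  coming from the \<open>B\<close>-coordinates from a correction that depends on the
  \<open>Q\<close>-coordinates alone. Validity of identities and centrality both follow from this
  splitting.\<close>

lemma eval_twisted:
  assumes Q: "ualgebra ar Q" and T: "T \<in> cocycles ar M Q" and "wf_trm ar t"
    and p: "\<And>x. p x \<in> carrier M" and v: "\<And>x. v x \<in> carrier Q"
  shows "eval_trm (twisted_product M B T Q) (\<lambda>x. (p x, v x)) t =
     (eval_trm B p t \<oplus> trm_cocycle M B T Q v t, eval_trm Q v t)"
  using assms(3)
proof (induction t)
  case (App f ts)
  have wf: "length ts = ar f" "\<And>t. t \<in> set ts \<Longrightarrow> wf_trm ar t"
    using App.prems by (auto simp: list_all_iff)
  have "map (eval_trm Q v) ts \<in> tuples (carrier Q) (ar f)"
    using wf eval_trm_closed[where v = v, OF Q _ v] by (auto simp: tuples_def)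
  then have Tc: "T f (map (eval_trm Q v) ts) \<in> carrier M" by (rule cocycle_closed[OF T])
  have c: "eval_trm B p t \<in> carrier M" "trm_cocycle M B T Q v t \<in> carrier M" if "t \<in> set ts" for t
    using eval_closed[where p = p, OF wf(2)[OF that] p] trm_cocycle_closed[where v = v, OF Q T wf(2)[OF that] v] by auto
  have "map fst (map (eval_trm (twisted_product M B T Q) (\<lambda>x. (p x, v x))) ts)
      = map (\<lambda>t. eval_trm B p t \<oplus> trm_cocycle M B T Q v t) ts"
    "map snd (map (eval_trm (twisted_product M B T Q) (\<lambda>x. (p x, v x))) ts) = map (eval_trm Q v) ts"
    using App.IH wf by auto
  then show ?case
    using oper_map_add[OF wf(1), of "eval_trm B p" "trm_cocycle M B T Q v"] c Tc
      oper_map_closed[OF wf(1), of "eval_trm B p"] oper_map_closed[OF wf(1), of "trm_cocycle M B T Q v"]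
    by (simp add: a_assoc del: map_map)
qed (use p in simp)

lemma twisted_snd_hom: "snd \<in> ua_hom ar (twisted_product M B T Q) Q"
  by (auto simp: ua_hom_def)

text \<open>By \<open>eval_twisted\<close>, an identity amounts to three equations: the same
  identity in \<open>B\<close>, the same identity in \<open>Q\<close>, and equality of the
  corrections, which is compatibility.\<close>

lemma twisted_in_variety:
  assumes E: "identities ar E" and B: "in_variety ar E B" and Q: "in_variety ar E Q"
    and T: "T \<in> cocycles ar M Q" and comp: "compatible ar E M B Q T"
  shows "in_variety ar E (twisted_product M B T Q)"
proof -
  have uQ: "ualgebra ar Q" using Q by (simp add: in_variety_def)
  have "satisfies (twisted_product M B T Q) (s, t)" if st: "(s, t) \<in> E" for s t
  proof -
    have wf: "wf_trm ar s" "wf_trm ar t" using st E by (auto simp: identities_def)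
    have I: "(s, t) \<in> identities_of_variety ar E"
      using wf st by (auto simp: identities_of_variety_def in_variety_def)
    have "eval_trm (twisted_product M B T Q) w s = eval_trm (twisted_product M B T Q) w t"
      if w: "w \<in> UNIV \<rightarrow> carrier M \<times> carrier Q" for w
    proof -
      have c: "fst (w x) \<in> carrier M" "snd (w x) \<in> carrier Q" for x
        using w by (metis PiE UNIV_I mem_Times_iff)+
      have "eval_trm B (\<lambda>x. fst (w x)) s = eval_trm B (\<lambda>x. fst (w x)) t"
        using B st c by (auto simp: in_variety_def satisfies_def carrier_B)
      moreover have "eval_trm Q (\<lambda>x. snd (w x)) s = eval_trm Q (\<lambda>x. snd (w x)) t"
        using Q st c by (auto simp: in_variety_def satisfies_def)
      moreover have "trm_cocycle M B T Q (\<lambda>x. snd (w x)) s = trm_cocycle M B T Q (\<lambda>x. snd (w x)) t"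
        using comp I c by (auto simp: compatible_def)
      ultimately show ?thesis
        using eval_twisted[where p = "\<lambda>x. fst (w x)" and v = "\<lambda>x. snd (w x)", OF uQ T wf(1) c] eval_twisted[where p = "\<lambda>x. fst (w x)" and v = "\<lambda>x. snd (w x)", OF uQ T wf(2) c] by simp
    qed
    then show ?thesis by (simp add: satisfies_def)
  qed
  then show ?thesis using twisted_ualgebra[OF uQ T] by (auto simp: in_variety_def)
qed

text \<open>Moving the first block of arguments inside its fibres changes the value of a term by a
  summand in \<open>B\<close> that does not depend on the second block. Equal values before the move
  therefore stay equal.\<close>

lemma twisted_central:
  assumes Q: "ualgebra ar Q" and T: "T \<in> cocycles ar M Q"
  shows "central_extension ar (twisted_product M B T Q) Q snd"
proof -
  let ?A = "twisted_product M B T Q"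
  have "term_condition ar ?A (ker_cong ?A snd) (greatest_cong ?A) (least_cong ?A)"
    unfolding term_condition_def
  proof (intro allI impI)
    fix t :: "('f, nat + nat) trm" and a b u v
    assume t: "wf_trm ar t" and ab: "\<forall>i. (a i, b i) \<in> ker_cong ?A snd"
      and uv: "\<forall>j. (u j, v j) \<in> greatest_cong ?A"
      and eq: "(eval_trm ?A (case_sum a u) t, eval_trm ?A (case_sum a v) t) \<in> least_cong ?A"
    have c: "a i \<in> carrier M \<times> carrier Q" "b i \<in> carrier M \<times> carrier Q"
      "u i \<in> carrier M \<times> carrier Q" "v i \<in> carrier M \<times> carrier Q" "snd (a i) = snd (b i)" for i
      using ab uv by (auto simp: ker_cong_def greatest_cong_def)
    \<comment> \<open>The displacement from \<open>a\<close> to \<open>b\<close>, extended by zero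
      on the second block; the value of \<open>t\<close> in \<open>B\<close> at \<open>d\<close> is
      the common summand for \<open>u\<close> and \<open>v\<close>.\<close>
    define d where "d = case_sum (\<lambda>i. fst (b i) \<ominus> fst (a i)) (\<lambda>_::nat. \<zero>)"
    have d: "d z \<in> carrier M" for z
      using c by (cases z) (auto simp: d_def mem_Times_iff)
    have shift: "eval_trm ?A (case_sum b p) t =
      (eval_trm B d t \<oplus> fst (eval_trm ?A (case_sum a p) t), snd (eval_trm ?A (case_sum a p) t))"
      if p: "\<And>j. p j \<in> carrier M \<times> carrier Q" for p
    proof -
      define w where "w = case_sum (fst \<circ> a) (fst \<circ> p)"
      define q where "q = case_sum (snd \<circ> a) (snd \<circ> p)"
      have w: "w z \<in> carrier M" and q: "q z \<in> carrier Q" for z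
        using c p by (cases z; simp add: w_def q_def mem_Times_iff)+
      have "fst (b i) = fst (b i) \<ominus> fst (a i) \<oplus> fst (a i)" for i
        using c[of i] by (auto simp: mem_Times_iff minus_eq a_assoc l_neg)
      then have "case_sum b p z = (d z \<oplus> w z, q z)" for z
        using c p by (cases z) (auto simp: d_def w_def q_def prod_eq_iff mem_Times_iff)
      then have B: "case_sum b p = (\<lambda>z. (d z \<oplus> w z, q z))" by auto
      have A: "case_sum a p = (\<lambda>z. (w z, q z))"
        by (auto simp: w_def q_def split: sum.split)
      show ?thesis
        unfolding A B
        using eval_twisted[OF Q T t, of "\<lambda>z. d z \<oplus> w z" q] eval_twisted[where p = w and v = q, OF Q T t w q]
          eval_add[where p = d and q = w, OF t d w] eval_closed[where p = d, OF t d] eval_closed[where p = w, OF t w] trm_cocycle_closed[where v = q, OF Q T t q] d w q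
        by (simp add: a_assoc)
    qed
    have "case_sum b u z \<in> carrier ?A" for z using c by (cases z) auto
    then have "eval_trm ?A (case_sum b u) t \<in> carrier ?A"
      by (rule eval_trm_closed[OF twisted_ualgebra[OF Q T] t])
    moreover have "eval_trm ?A (case_sum b u) t = eval_trm ?A (case_sum b v) t"
      unfolding shift[of u, OF c(3)] shift[of v, OF c(4)] using eq by (auto simp: least_cong_def)
    ultimately show "(eval_trm ?A (case_sum b u) t, eval_trm ?A (case_sum b v) t) \<in> least_cong ?A"
      by (auto simp: least_cong_def)
  qed
  from commutator_eq_least_cong[OF twisted_ualgebra[OF Q T] this]
  have "commutator ar ?A (ker_cong ?A snd) (greatest_cong ?A) = least_cong ?A" .
  moreover have "carrier M \<noteq> {}" by auto
  ultimately show ?thesis using twisted_snd_hom by (auto simp: central_extension_def)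
qed

section \<open>Pulling cocycles back along a homomorphism\<close>

lemma pull_cocycle_closed:
  assumes \<pi>: "\<pi> \<in> ua_hom ar Q P" and S: "S \<in> cocycles ar M P"
  shows "pull_cocycle ar Q \<pi> S \<in> cocycles ar M Q"
proof -
  have "map \<pi> qs \<in> tuples (carrier P) n" if "qs \<in> tuples (carrier Q) n" for qs n
    by (rule map_tuples[OF that]) (use \<pi> in \<open>auto simp: ua_hom_def\<close>)
  then show ?thesis using cocycle_closed[OF S] by (auto simp: cocycles_def pull_cocycle_def)
qed

lemma trm_cocycle_pull:
  assumes Q: "ualgebra ar Q" and \<pi>: "\<pi> \<in> ua_hom ar Q P" and "wf_trm ar t"
    and v: "\<And>x. v x \<in> carrier Q"
  shows "trm_cocycle M B (pull_cocycle ar Q \<pi> S) Q v t = trm_cocycle M B S P (\<lambda>x. \<pi> (v x)) t"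
  using assms(3)
proof (induction t)
  case (App f ts)
  have "map (eval_trm Q v) ts \<in> tuples (carrier Q) (ar f)"
    using App.prems eval_trm_closed[where v = v, OF Q _ v] by (auto simp: tuples_def list_all_iff)
  moreover have "map (trm_cocycle M B (pull_cocycle ar Q \<pi> S) Q v) ts =
      map (trm_cocycle M B S P (\<lambda>x. \<pi> (v x))) ts"
    using App by (auto simp: list_all_iff)
  moreover have "map \<pi> (map (eval_trm Q v) ts) = map (eval_trm P (\<lambda>x. \<pi> (v x))) ts"
    using App.prems eval_trm_hom[where v = v, OF Q \<pi> _ v] by (auto simp: list_all_iff)
  ultimately show ?case
    unfolding trm_cocycle.simps
    by (simp add: pull_cocycle_def[of _ _ _ S, THEN fun_cong] del: map_map map_eq_conv)
qed simp

text \<open>Every evaluation in \<open>P\<close> is the image of one in \<open>Q\<close>, so by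
  \<open>trm_cocycle_pull\<close> both conditions test the same equations. The implication from left
  to right lets compatibility descend to the quotient.\<close>

lemma compatible_pull_iff:
  assumes Q: "ualgebra ar Q" and \<pi>: "\<pi> \<in> ua_hom ar Q P" and surj: "\<pi> ` carrier Q = carrier P"
  shows "compatible ar E M B Q (pull_cocycle ar Q \<pi> S) \<longleftrightarrow> compatible ar E M B P S"
proof
  assume L: "compatible ar E M B Q (pull_cocycle ar Q \<pi> S)"
  have "trm_cocycle M B S P v s = trm_cocycle M B S P v t"
    if st: "(s, t) \<in> identities_of_variety ar E" and v: "v \<in> UNIV \<rightarrow> carrier P" for s t v
  proof -
    have "v x \<in> \<pi> ` carrier Q" for x using v surj by auto
    then have "\<exists>w. \<forall>x. w x \<in> carrier Q \<and> \<pi> (w x) = v x" by (intro choice) (metis imageE)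
    then obtain w where w: "\<And>x. w x \<in> carrier Q" "\<And>x. \<pi> (w x) = v x" by auto
    have wf: "wf_trm ar s" "wf_trm ar t" using st by (auto simp: identities_of_variety_def)
    have "w \<in> UNIV \<rightarrow> carrier Q" using w by auto
    then have "trm_cocycle M B (pull_cocycle ar Q \<pi> S) Q w s = trm_cocycle M B (pull_cocycle ar Q \<pi> S) Q w t"
      using L st by (auto simp: compatible_def)
    then show ?thesis
      using trm_cocycle_pull[OF Q \<pi> wf(1), of w] trm_cocycle_pull[OF Q \<pi> wf(2), of w] w by simp
  qed
  then show "compatible ar E M B P S" by (auto simp: compatible_def)
next
  assume R: "compatible ar E M B P S"
  have "trm_cocycle M B (pull_cocycle ar Q \<pi> S) Q w s = trm_cocycle M B (pull_cocycle ar Q \<pi> S) Q w t"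
    if st: "(s, t) \<in> identities_of_variety ar E" and w: "w \<in> UNIV \<rightarrow> carrier Q" for s t w
  proof -
    have wf: "wf_trm ar s" "wf_trm ar t" using st by (auto simp: identities_of_variety_def)
    have w': "w x \<in> carrier Q" for x using w by auto
    then have "(\<lambda>x. \<pi> (w x)) \<in> UNIV \<rightarrow> carrier P" using surj by auto
    then have "trm_cocycle M B S P (\<lambda>x. \<pi> (w x)) s = trm_cocycle M B S P (\<lambda>x. \<pi> (w x)) t"
      using R st by (auto simp: compatible_def)
    then show ?thesis
      using trm_cocycle_pull[OF Q \<pi> wf(1), of w] trm_cocycle_pull[OF Q \<pi> wf(2), of w] w' by simp
  qed
  then show "compatible ar E M B Q (pull_cocycle ar Q \<pi> S)" by (auto simp: compatible_def)
qed

section \<open>Cohomologous cocycles and cohomology classes\<close>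

text \<open>Subtraction is avoided by moving terms across, so \<open>S\<close> - \<open>T\<close> is
  the coboundary of the negative of \<open>h\<close>. Equivalently, (b, q) \<mapsto> (b + h q, q) is
  a homomorphism from the product twisted by \<open>T\<close> to the one twisted by
  \<open>S\<close>.\<close>

definition cohomologous :: "('f, 'q) ualg \<Rightarrow> ('f, 'q, 'b) cochain \<Rightarrow> ('f, 'q, 'b) cochain \<Rightarrow> bool" where
  "cohomologous Q S T \<longleftrightarrow> (\<exists>h\<in>carrier Q \<rightarrow> carrier M. \<forall>f. \<forall>qs\<in>tuples (carrier Q) (ar f).
     S f qs \<oplus> oper B f (map h qs) = T f qs \<oplus> h (oper Q f qs))"

lemma map_closed:
  "\<lbrakk>h \<in> carrier Q \<rightarrow> carrier M; qs \<in> tuples (carrier Q) (ar f)\<rbrakk> \<Longrightarrow> oper B f (map h qs) \<in> carrier M"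
  by (rule oper_closed) (auto simp: tuples_def)

lemma cohomologous_refl:
  assumes T: "T \<in> cocycles ar M Q"
  shows "cohomologous Q T T"
  unfolding cohomologous_def
  by (rule bexI[of _ "\<lambda>_. \<zero>"]) (use cocycle_closed[OF T] in \<open>auto simp: oper_map_zero tuples_def\<close>)

lemma cohomologous_sym:
  assumes Q: "ualgebra ar Q" and S: "S \<in> cocycles ar M Q" and T: "T \<in> cocycles ar M Q"
    and ST: "cohomologous Q S T"
  shows "cohomologous Q T S"
proof -
  obtain h where h: "h \<in> carrier Q \<rightarrow> carrier M" and
    eq: "\<And>f qs. qs \<in> tuples (carrier Q) (ar f) \<Longrightarrow>
      S f qs \<oplus> oper B f (map h qs) = T f qs \<oplus> h (oper Q f qs)"
    using ST by (auto simp: cohomologous_def)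
  have "T f qs \<oplus> oper B f (map (\<lambda>q. \<ominus> h q) qs) = S f qs \<oplus> \<ominus> h (oper Q f qs)"
    if qs: "qs \<in> tuples (carrier Q) (ar f)" for f qs
  proof -
    have c: "S f qs \<in> carrier M" "T f qs \<in> carrier M" "h (oper Q f qs) \<in> carrier M"
        "oper B f (map h qs) \<in> carrier M"
      using cocycle_closed[OF S qs] cocycle_closed[OF T qs] map_closed[OF h qs] h Q qs
      by (auto simp: ualgebra_def)
    have "oper B f (map (\<lambda>q. \<ominus> h q) qs) = \<ominus> oper B f (map h qs)"
      by (rule oper_map_neg) (use qs h in \<open>auto simp: tuples_def\<close>)
    moreover have "T f qs = S f qs \<oplus> oper B f (map h qs) \<oplus> \<ominus> h (oper Q f qs)"
      using c unfolding eq[OF qs] by (simp add: a_assoc r_neg)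
    then have "T f qs \<oplus> \<ominus> oper B f (map h qs) =
        S f qs \<oplus> (\<ominus> h (oper Q f qs) \<oplus> (oper B f (map h qs) \<oplus> \<ominus> oper B f (map h qs)))"
      using c by (simp add: a_ac del: r_neg)
    ultimately show ?thesis using c by (simp add: r_neg)
  qed
  then show ?thesis unfolding cohomologous_def by (intro bexI[of _ "\<lambda>q. \<ominus> h q"]) (use h in auto)
qed

lemma cohomologous_trans:
  assumes Q: "ualgebra ar Q" and S: "S \<in> cocycles ar M Q" and T: "T \<in> cocycles ar M Q"
    and U: "U \<in> cocycles ar M Q" and ST: "cohomologous Q S T" and TU: "cohomologous Q T U"
  shows "cohomologous Q S U"
proof -
  obtain h where h: "h \<in> carrier Q \<rightarrow> carrier M" and
    eq: "\<And>f qs. qs \<in> tuples (carrier Q) (ar f) \<Longrightarrow>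
      S f qs \<oplus> oper B f (map h qs) = T f qs \<oplus> h (oper Q f qs)"
    using ST by (auto simp: cohomologous_def)
  obtain k where k: "k \<in> carrier Q \<rightarrow> carrier M" and
    eq': "\<And>f qs. qs \<in> tuples (carrier Q) (ar f) \<Longrightarrow>
      T f qs \<oplus> oper B f (map k qs) = U f qs \<oplus> k (oper Q f qs)"
    using TU by (auto simp: cohomologous_def)
  have "S f qs \<oplus> oper B f (map (\<lambda>q. h q \<oplus> k q) qs) = U f qs \<oplus> (h (oper Q f qs) \<oplus> k (oper Q f qs))"
    if qs: "qs \<in> tuples (carrier Q) (ar f)" for f qs
  proof -
    have c: "S f qs \<in> carrier M" "T f qs \<in> carrier M" "U f qs \<in> carrier M"
        "h (oper Q f qs) \<in> carrier M" "k (oper Q f qs) \<in> carrier M"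
        "oper B f (map h qs) \<in> carrier M" "oper B f (map k qs) \<in> carrier M"
      using cocycle_closed[OF S qs] cocycle_closed[OF T qs] cocycle_closed[OF U qs]
        map_closed[OF h qs] map_closed[OF k qs] h k Q qs
      by (auto simp: ualgebra_def)
    have "oper B f (map (\<lambda>q. h q \<oplus> k q) qs) = oper B f (map h qs) \<oplus> oper B f (map k qs)"
      by (rule oper_map_add) (use qs h k in \<open>auto simp: tuples_def\<close>)
    then have "S f qs \<oplus> oper B f (map (\<lambda>q. h q \<oplus> k q) qs) =
        (S f qs \<oplus> oper B f (map h qs)) \<oplus> oper B f (map k qs)"
      using c by (simp add: a_assoc)
    also have "\<dots> = (T f qs \<oplus> oper B f (map k qs)) \<oplus> h (oper Q f qs)"
      unfolding eq[OF qs] using c by (simp add: a_ac)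
    also have "\<dots> = U f qs \<oplus> (h (oper Q f qs) \<oplus> k (oper Q f qs))"
      unfolding eq'[OF qs] using c by (simp add: a_ac)
    finally show ?thesis .
  qed
  then show ?thesis unfolding cohomologous_def
    by (intro bexI[of _ "\<lambda>q. h q \<oplus> k q"]) (use h k in auto)
qed

text \<open>Replaces the coset by a relation between cocycles, so that later arguments can work with
  a single function \<open>h\<close>.\<close>

lemma coh_class_eq_cohomologous:
  assumes Q: "ualgebra ar Q" and S: "S \<in> cocycles ar M Q"
  shows "coh_class ar E M B Q S = {T \<in> cocycles ar M Q. cohomologous Q T S}"
proof -
  define cob where "cob h = (\<lambda>f. \<lambda>qs\<in>tuples (carrier Q) (ar f).
    (oper B f (map h qs) \<ominus> h (oper Q f qs)) \<oplus> S f qs)" for h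
  have cls: "coh_class ar E M B Q S = cob ` (carrier Q \<rightarrow> carrier M)"
  proof -
    have "coh_class ar E M B Q S = (\<lambda>U f. \<lambda>qs\<in>tuples (carrier Q) (ar f). U f qs \<oplus> S f qs) `
        coboundaries ar M B Q"
      by (auto simp: coh_class_def r_coset_def compatible_cocycles_def)
    also have "\<dots> = cob ` (carrier Q \<rightarrow> carrier M)"
      unfolding coboundaries_def Setcompr_eq_image image_image Collect_mem_eq cob_def
      by (intro image_cong refl ext) (simp add: restrict_def)
    finally show ?thesis .
  qed
  \<comment> \<open>The coset element given by \<open>h\<close> has the negative of \<open>h\<close>
    as its witness in \<open>cohomologous\<close>. Keeping \<open>x\<close> arbitrary makes the
    equivalence serve both inclusions.\<close>
  have step: "x = cob h f qs \<longleftrightarrow> x \<oplus> oper B f (map (\<lambda>q. \<ominus> h q) qs) = S f qs \<oplus> \<ominus> h (oper Q f qs)"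
    if h: "h \<in> carrier Q \<rightarrow> carrier M" and qs: "qs \<in> tuples (carrier Q) (ar f)" and x: "x \<in> carrier M"
    for h f qs x
  proof -
    have c: "S f qs \<in> carrier M" "h (oper Q f qs) \<in> carrier M" "oper B f (map h qs) \<in> carrier M"
      using cocycle_closed[OF S qs] map_closed[OF h qs] h Q qs by (auto simp: ualgebra_def)
    have "oper B f (map (\<lambda>q. \<ominus> h q) qs) = \<ominus> oper B f (map h qs)"
      by (rule oper_map_neg) (use qs h in \<open>auto simp: tuples_def\<close>)
    moreover have "cob h f qs = S f qs \<oplus> \<ominus> h (oper Q f qs) \<oplus> oper B f (map h qs)"
      using qs c by (simp add: cob_def minus_eq a_ac)
    moreover have "x = y \<oplus> z \<longleftrightarrow> x \<oplus> \<ominus> z = y" if "x \<in> carrier M" "y \<in> carrier M" "z \<in> carrier M" for x y z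
      using that by (metis a_assoc a_inv_closed l_neg r_neg r_zero)
    ultimately show ?thesis using x c by simp
  qed
  show ?thesis
  proof (intro equalityI subsetI)
    fix T assume "T \<in> coh_class ar E M B Q S"
    then obtain h where h: "h \<in> carrier Q \<rightarrow> carrier M" and T: "T = cob h" by (auto simp: cls)
    have "cob h f qs \<in> carrier M" if qs: "qs \<in> tuples (carrier Q) (ar f)" for f qs
    proof -
      have "h (oper Q f qs) \<in> carrier M" using h Q qs by (auto simp: ualgebra_def)
      then show ?thesis using cocycle_closed[OF S qs] map_closed[OF h qs] qs by (simp add: cob_def)
    qed
    moreover have "cob h f \<in> extensional (tuples (carrier Q) (ar f))" for f by (simp add: cob_def)
    ultimately have "T \<in> cocycles ar M Q" by (auto simp: T cocycles_def PiE_def)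
    moreover have "cohomologous Q T S"
      unfolding cohomologous_def
      using step[OF h, THEN iffD1, OF _ _ refl] cocycle_closed[OF \<open>T \<in> cocycles ar M Q\<close>] h
      by (intro bexI[of _ "\<lambda>q. \<ominus> h q"]) (auto simp: T)
    ultimately show "T \<in> {T \<in> cocycles ar M Q. cohomologous Q T S}" by simp
  next
    fix T assume *: "T \<in> {T \<in> cocycles ar M Q. cohomologous Q T S}"
    then obtain h where h: "h \<in> carrier Q \<rightarrow> carrier M" and
      eq: "\<And>f qs. qs \<in> tuples (carrier Q) (ar f) \<Longrightarrow>
        T f qs \<oplus> oper B f (map h qs) = S f qs \<oplus> h (oper Q f qs)"
      by (auto simp: cohomologous_def)
    define k where "k q = \<ominus> h q" for q
    have k: "k \<in> carrier Q \<rightarrow> carrier M" using h by (simp add: k_def Pi_iff)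
    have "T f qs = cob k f qs" for f qs
    proof (cases "qs \<in> tuples (carrier Q) (ar f)")
      case True
      have "map (\<lambda>q. \<ominus> k q) qs = map h qs" "\<ominus> k (oper Q f qs) = h (oper Q f qs)"
        using h Q True by (auto simp: k_def tuples_def ualgebra_def minus_minus Pi_iff subset_iff)
      then show ?thesis using step[OF k True, of "T f qs"] cocycle_closed[of T Q, OF _ True] * eq[OF True] by (simp del: map_eq_conv)
    next
      case False
      moreover from this have "T f qs = undefined"
        using * by (auto simp: cocycles_def PiE_def extensional_def)
      ultimately show ?thesis by (simp add: cob_def)
    qed
    then have "T = cob k" by (simp add: fun_eq_iff)
    then show "T \<in> coh_class ar E M B Q S" using k by (auto simp: cls)
  qed
qed

lemma coh_class_eq_iff:
  assumes Q: "ualgebra ar Q" and S: "S \<in> cocycles ar M Q" and T: "T \<in> cocycles ar M Q"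
  shows "coh_class ar E M B Q S = coh_class ar E M B Q T \<longleftrightarrow> cohomologous Q S T"
  unfolding coh_class_eq_cohomologous[OF Q S] coh_class_eq_cohomologous[OF Q T]
  using cohomologous_refl[OF S] cohomologous_sym[OF Q] cohomologous_trans[OF Q] S T by blast

lemma cohomologous_pull:
  assumes \<pi>: "\<pi> \<in> ua_hom ar Q P" and ST: "cohomologous P S T"
  shows "cohomologous Q (pull_cocycle ar Q \<pi> S) (pull_cocycle ar Q \<pi> T)"
proof -
  obtain h where h: "h \<in> carrier P \<rightarrow> carrier M" and
    eq: "\<And>f qs. qs \<in> tuples (carrier P) (ar f) \<Longrightarrow>
      S f qs \<oplus> oper B f (map h qs) = T f qs \<oplus> h (oper P f qs)"
    using ST by (auto simp: cohomologous_def)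
  have "map \<pi> qs \<in> tuples (carrier P) n" if "qs \<in> tuples (carrier Q) n" for qs n
    by (rule map_tuples[OF that]) (use \<pi> in \<open>auto simp: ua_hom_def\<close>)
  then show ?thesis
    unfolding cohomologous_def
    using eq h \<pi> by (intro bexI[of _ "h \<circ> \<pi>"]) (fastforce simp: pull_cocycle_def ua_hom_def)+
qed

text \<open>The image inside \<open>the_elem\<close> is a singleton: pulling back preserves
  \<open>cohomologous\<close>, so all members of the class give one value, and \<open>S\<close> is a
  member of its own class.\<close>

lemma inflation_coh_class:
  assumes Q: "ualgebra ar Q" and P: "ualgebra ar P" and \<pi>: "\<pi> \<in> ua_hom ar Q P"
    and S: "S \<in> cocycles ar M P"
  shows "inflation ar E M B Q \<pi> (coh_class ar E M B P S) = coh_class ar E M B Q (pull_cocycle ar Q \<pi> S)"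
proof -
  have "coh_class ar E M B Q (pull_cocycle ar Q \<pi> S') = coh_class ar E M B Q (pull_cocycle ar Q \<pi> S)"
    if "S' \<in> coh_class ar E M B P S" for S'
    using that cohomologous_pull[OF \<pi>] pull_cocycle_closed[OF \<pi>] S coh_class_eq_iff[OF Q]
    by (auto simp: coh_class_eq_cohomologous[OF P S])
  moreover have "S \<in> coh_class ar E M B P S"
    using S cohomologous_refl by (auto simp: coh_class_eq_cohomologous[OF P S])
  ultimately have "(\<lambda>S'. coh_class ar E M B Q (pull_cocycle ar Q \<pi> S')) ` coh_class ar E M B P S =
      {coh_class ar E M B Q (pull_cocycle ar Q \<pi> S)}" by blast
  then show ?thesis by (simp add: inflation_def)
qed

text \<open>The fact \<open>change\<close> extends the coboundary equation from operation symbols to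
  terms. For the two sides of an identity, the values in \<open>B\<close>, in \<open>Q\<close> and
  for \<open>T\<close> agree, so those for \<open>S\<close> agree by cancellation.\<close>

lemma compatible_cohomologous:
  assumes E: "identities ar E" and B: "in_variety ar E B" and Qv: "in_variety ar E Q"
    and S: "S \<in> cocycles ar M Q" and T: "T \<in> cocycles ar M Q"
    and ST: "cohomologous Q S T" and comp: "compatible ar E M B Q T"
  shows "compatible ar E M B Q S"
proof -
  have Q: "ualgebra ar Q" using Qv by (simp add: in_variety_def)
  obtain h where h: "h \<in> carrier Q \<rightarrow> carrier M" and
    eq: "\<And>f qs. qs \<in> tuples (carrier Q) (ar f) \<Longrightarrow>
      S f qs \<oplus> oper B f (map h qs) = T f qs \<oplus> h (oper Q f qs)"
    using ST by (auto simp: cohomologous_def)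
  have change: "trm_cocycle M B S Q v t \<oplus> eval_trm B (\<lambda>x. h (v x)) t =
      trm_cocycle M B T Q v t \<oplus> h (eval_trm Q v t)"
    if "wf_trm ar t" and v: "\<And>x. v x \<in> carrier Q" for t :: "('f, nat) trm" and v
    using that(1)
  proof (induction t)
    case (Var x)
    then show ?case using v h by auto
  next
    case (App f ts)
    have wf: "length ts = ar f" "\<And>t. t \<in> set ts \<Longrightarrow> wf_trm ar t"
      using App.prems by (auto simp: list_all_iff)
    let ?q = "map (eval_trm Q v) ts"
    let ?s = "trm_cocycle M B S Q v" and ?t = "trm_cocycle M B T Q v"
    let ?e = "eval_trm B (\<lambda>x. h (v x))" and ?k = "\<lambda>t. h (eval_trm Q v t)"
    have hv: "h (v x) \<in> carrier M" for x using h v by auto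
    have q: "?q \<in> tuples (carrier Q) (ar f)"
      using wf eval_trm_closed[where v = v, OF Q _ v] by (auto simp: tuples_def)
    have k: "?k t \<in> carrier M" if "t \<in> set ts" for t
      using eval_trm_closed[OF Q wf(2)[OF that], of v] v h by auto
    have s: "?s t \<in> carrier M" "?t t \<in> carrier M" "?e t \<in> carrier M" if "t \<in> set ts" for t
      using trm_cocycle_closed[where v = v, OF Q S wf(2)[OF that] v] trm_cocycle_closed[where v = v, OF Q T wf(2)[OF that] v]
        eval_closed[OF wf(2)[OF that], of "\<lambda>x. h (v x)"] hv by auto
    have c: "S f ?q \<in> carrier M" "T f ?q \<in> carrier M" "h (oper Q f ?q) \<in> carrier M"
        "oper B f (map ?s ts) \<in> carrier M" "oper B f (map ?t ts) \<in> carrier M"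
        "oper B f (map ?e ts) \<in> carrier M" "oper B f (map ?k ts) \<in> carrier M"
      using cocycle_closed[OF S q] cocycle_closed[OF T q] h Q q oper_map_closed[OF wf(1)] s k
      by (auto simp: ualgebra_def)
    \<comment> \<open>The induction hypotheses equate the arguments of \<open>oper B f\<close>;
      additivity splits the result, and the coboundary equation for \<open>f\<close> then exchanges
      \<open>S\<close> for \<open>T\<close>.\<close>
    have "map (\<lambda>t. ?s t \<oplus> ?e t) ts = map (\<lambda>t. ?t t \<oplus> ?k t) ts" using App.IH wf by auto
    then have 1: "oper B f (map ?s ts) \<oplus> oper B f (map ?e ts) = oper B f (map ?t ts) \<oplus> oper B f (map ?k ts)"
      by (simp only: oper_map_add[OF wf(1) s(1,3), symmetric] oper_map_add[OF wf(1) s(2) k, symmetric])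
    have 2: "S f ?q \<oplus> oper B f (map ?k ts) = T f ?q \<oplus> h (oper Q f ?q)"
      using eq[OF q] by (simp add: comp_def)
    have "oper B f (map ?s ts) \<oplus> S f ?q \<oplus> oper B f (map ?e ts) =
        (oper B f (map ?s ts) \<oplus> oper B f (map ?e ts)) \<oplus> S f ?q"
      using c by (simp add: a_ac)
    also have "\<dots> = oper B f (map ?t ts) \<oplus> (S f ?q \<oplus> oper B f (map ?k ts))"
      unfolding 1 using c by (simp add: a_ac)
    also have "\<dots> = oper B f (map ?t ts) \<oplus> T f ?q \<oplus> h (oper Q f ?q)"
      unfolding 2 using c by (simp add: a_ac)
    finally show ?case by simp
  qed
  have "trm_cocycle M B S Q v s = trm_cocycle M B S Q v t"
    if st: "(s, t) \<in> identities_of_variety ar E" and v: "v \<in> UNIV \<rightarrow> carrier Q" for s t v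
  proof -
    have wf: "wf_trm ar s" "wf_trm ar t" using st by (auto simp: identities_of_variety_def)
    have v': "v x \<in> carrier Q" for x using v by auto
    then have hv: "h (v x) \<in> carrier M" for x using h by auto
    have "eval_trm B (\<lambda>x. h (v x)) s = eval_trm B (\<lambda>x. h (v x)) t"
      using identities_of_variety_satisfied[OF E B st] hv by (auto simp: satisfies_def carrier_B)
    moreover have "eval_trm Q v s = eval_trm Q v t"
      using identities_of_variety_satisfied[OF E Qv st] v by (auto simp: satisfies_def)
    moreover have "trm_cocycle M B T Q v s = trm_cocycle M B T Q v t"
      using comp st v by (auto simp: compatible_def)
    ultimately have "trm_cocycle M B S Q v s \<oplus> eval_trm B (\<lambda>x. h (v x)) t =
        trm_cocycle M B S Q v t \<oplus> eval_trm B (\<lambda>x. h (v x)) t"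
      using change[of s v, OF wf(1) v'] change[of t v, OF wf(2) v'] by simp
    then show ?thesis
      using trm_cocycle_closed[where v = v, OF Q S wf(1) v'] trm_cocycle_closed[where v = v, OF Q S wf(2) v'] eval_closed[where p = "\<lambda>x. h (v x)", OF wf(2) hv]
      by (simp add: cancel_right)
  qed
  then show ?thesis by (auto simp: compatible_def)
qed

end

section \<open>Additivity of kernel algebras\<close>

lemma kernel_algebra_additive:
  assumes K: "kernel_algebra ar m R M B" and B: "ualgebra ar B"
  shows "additive_ualg M ar B"
proof -
  interpret unital_module R M using K by (simp add: kernel_algebra_def)
  show ?thesis
  proof
    show "ualgebra ar B" by (rule B)
    show "carrier B = carrier M" using K by (simp add: kernel_algebra_def)
    fix xs ys f
    assume xs: "xs \<in> tuples (carrier M) (ar f)" and ys: "ys \<in> tuples (carrier M) (ar f)"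
    have xsi: "xs ! i \<in> carrier M" "ys ! i \<in> carrier M" if "i < ar f" for i
      using xs ys that unfolding tuples_def by (metis (mono_tags, lifting) mem_Collect_eq nth_mem subsetD)+
    have zs: "map2 (\<oplus>\<^bsub>M\<^esub>) xs ys \<in> tuples (carrier M) (ar f)"
      using xsi xs ys by (auto simp: tuples_def in_set_conv_nth)
    obtain r where r: "r \<in> {..<ar f} \<rightarrow> carrier R" and
      eq: "\<And>xs. xs \<in> tuples (carrier M) (ar f) \<Longrightarrow>
        oper B f xs = (\<Oplus>\<^bsub>M\<^esub>i\<in>{..<ar f}. r i \<odot>\<^bsub>M\<^esub> xs ! i)"
      using K unfolding kernel_algebra_def by blast
    have "(\<Oplus>\<^bsub>M\<^esub>i\<in>{..<ar f}. r i \<odot>\<^bsub>M\<^esub> map2 (\<oplus>\<^bsub>M\<^esub>) xs ys ! i) =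
        (\<Oplus>\<^bsub>M\<^esub>i\<in>{..<ar f}. r i \<odot>\<^bsub>M\<^esub> xs ! i \<oplus>\<^bsub>M\<^esub> r i \<odot>\<^bsub>M\<^esub> ys ! i)"
      by (rule M.finsum_cong')
        (use xsi r xs ys in \<open>auto simp: tuples_def smult_r_distr Pi_iff\<close>)
    also have "\<dots> = (\<Oplus>\<^bsub>M\<^esub>i\<in>{..<ar f}. r i \<odot>\<^bsub>M\<^esub> xs ! i) \<oplus>\<^bsub>M\<^esub> (\<Oplus>\<^bsub>M\<^esub>i\<in>{..<ar f}. r i \<odot>\<^bsub>M\<^esub> ys ! i)"
      by (rule M.finsum_addf) (use xsi r in auto)
    finally show "oper B f (map2 (\<oplus>\<^bsub>M\<^esub>) xs ys) = oper B f xs \<oplus>\<^bsub>M\<^esub> oper B f ys"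
      using eq xs ys zs by simp
  qed
qed

section \<open>Translation invariance and descent to the abelianization\<close>

context additive_ualg
begin

text \<open>Translation by \<open>c\<close> is the unary polynomial z \<mapsto> m((c,q), (0,q), z),
  and polynomials preserve congruences.\<close>

lemma twisted_congruence_translate:
  assumes T: "T \<in> cocycles ar M Q" and ar: "ar m = 3"
    and mB: "\<And>x y z. \<lbrakk>x \<in> carrier M; y \<in> carrier M; z \<in> carrier M\<rbrakk> \<Longrightarrow> oper B m [x, y, z] = x \<ominus> y \<oplus> z"
    and m: "difference_operation ar (twisted_product M B T Q) m"
    and \<theta>: "\<theta> \<in> congruences ar (twisted_product M B T Q)"
    and xy: "((b, q), (b', q')) \<in> \<theta>" and c: "c \<in> carrier M"
  shows "((c \<oplus> b, q), (c \<oplus> b', q')) \<in> \<theta>"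
proof -
  let ?A = "twisted_product M B T Q"
  have cl: "b \<in> carrier M" "b' \<in> carrier M" "q \<in> carrier Q" "q' \<in> carrier Q"
    using congruencesD(5,6)[OF \<theta> xy] by auto
  have shift: "oper ?A m [(c, q), (\<zero>, q), (a, p)] = (c \<oplus> a, p)"
    if a: "a \<in> carrier M" and p: "p \<in> carrier Q" for a p
  proof -
    \<comment> \<open>Reading m(x,x,y) = y at \<open>B\<close>-coordinate zero shows that the
      cocycle value \<open>T m [q, q, p]\<close> vanishes, so no correction is left in the
      translation.\<close>
    have "oper ?A m [(\<zero>, q), (\<zero>, q), (\<zero>, p)] = (\<zero>, p)"
      using m cl p unfolding difference_operation_def by auto
    moreover have "T m [q, q, p] \<in> carrier M"
      by (rule cocycle_closed[OF T]) (use cl p ar in \<open>auto simp: tuples_def\<close>)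
    moreover have "\<ominus> \<zero> = \<zero>" by (rule minus_equality) simp_all
    ultimately have "T m [q, q, p] = \<zero>" "oper Q m [q, q, p] = p"
      by (auto simp: mB minus_eq)
    then show ?thesis using a c by (simp add: mB minus_eq)
  qed
  have "(oper ?A m [(c, q), (\<zero>, q), (b, q)], oper ?A m [(c, q), (\<zero>, q), (b', q')]) \<in> \<theta>"
    using congruence_oper_map[OF \<theta>, of "[((c, q), (c, q)), ((\<zero>, q), (\<zero>, q)), ((b, q), (b', q'))]" m fst snd]
      xy ar congruencesD(4)[OF \<theta>] cl c by auto
  then show ?thesis using shift cl by simp
qed

text \<open>Since \<open>D = [1,1]\<close> is invariant under translations of \<open>B\<close> and meets the kernel of the projection
  trivially, it relates \<open>(0, q)\<close> to exactly one element \<open>(h q, q\<^sub>0)\<close> over the representative \<open>q\<^sub>0\<close> of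
  the class of \<open>q\<close>. Correcting \<open>T\<close> by the coboundary of \<open>h\<close> makes it constant on the classes.\<close>

lemma descends_to_abelianization:
  fixes Q :: "('f, 'q) ualg" and T :: "('f, 'q, 'b) cochain"
  assumes Q: "ualgebra ar Q" and T: "T \<in> cocycles ar M Q" and ar: "ar m = 3"
    and mB: "\<And>x y z. \<lbrakk>x \<in> carrier M; y \<in> carrier M; z \<in> carrier M\<rbrakk> \<Longrightarrow> oper B m [x, y, z] = x \<ominus> y \<oplus> z"
    and m: "difference_operation ar (twisted_product M B T Q) m"
    and ker: "ker_cong (twisted_product M B T Q) snd \<inter> derived_cong ar (twisted_product M B T Q)
      = least_cong (twisted_product M B T Q)"
  obtains S where "S \<in> cocycles ar M (quotient_ualg Q (derived_cong ar Q))"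
    "cohomologous Q (pull_cocycle ar Q (canonical_hom (derived_cong ar Q)) S) T"
    "abelian_ualg ar (twisted_product M B S (quotient_ualg Q (derived_cong ar Q)))"
proof -
  define A where "A = twisted_product M B T Q"
  define D where "D = derived_cong ar A"
  define DQ where "DQ = derived_cong ar Q"
  define \<pi> where "\<pi> = canonical_hom DQ"
  define P where "P = quotient_ualg Q DQ"
  have A: "ualgebra ar A" unfolding A_def by (rule twisted_ualgebra[OF Q T])
  have mA: "difference_operation ar A m" using m by (simp add: A_def)
  have cA: "carrier A = carrier M \<times> carrier Q" by (simp add: A_def)
  have D: "D \<in> congruences ar A" unfolding D_def by (rule derived_cong_congruence[OF A])
  have DQ: "DQ \<in> congruences ar Q" unfolding DQ_def by (rule derived_cong_congruence[OF Q])
  have snd: "snd \<in> ua_hom ar A Q" unfolding A_def by (rule twisted_snd_hom)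
  have surj: "snd ` carrier A = carrier Q" unfolding cA by force
  have tr: "((c \<oplus> b, q), (c \<oplus> b', q')) \<in> D" if "((b, q), (b', q')) \<in> D" "c \<in> carrier M" for b q b' q' c
    using twisted_congruence_translate[OF T ar mB m _ that] D by (simp add: A_def)
  have cD: "b \<in> carrier M" "q \<in> carrier Q" "b' \<in> carrier M" "q' \<in> carrier Q"
    if "((b, q), (b', q')) \<in> D" for b q b' q'
    using congruencesD(5,6)[OF D that] by (auto simp: cA)
  have uniq: "b = b'" if "((b, q), (b', q)) \<in> D" for b b' q
  proof -
    have "((b, q), (b', q)) \<in> ker_cong A snd \<inter> D"
      using that cD[OF that] by (auto simp: ker_cong_def cA)
    then show ?thesis using ker by (auto simp: A_def D_def least_cong_def)
  qed
  \<comment> \<open>The image of \<open>D\<close> in \<open>Q\<close>. Fixing the first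
    \<open>B\<close>-coordinate to zero loses nothing, because any related pair can be translated to
    this form; this is \<open>RI\<close>.\<close>
  define R where "R = {(q, q'). \<exists>c. ((\<zero>, q), (c, q')) \<in> D}"
  have RI: "(q, q') \<in> R" if "((b, q), (b', q')) \<in> D" for b b' q q'
    using tr[OF that, of "\<ominus> b"] cD[OF that] by (auto simp: R_def l_neg)
  have "R \<in> congruences ar Q"
  proof -
    have "equiv (carrier Q) R"
    proof (rule equivI)
      show "R \<subseteq> carrier Q \<times> carrier Q" using cD by (auto simp: R_def)
      show "refl_on (carrier Q) R"
        using congruencesD(4)[OF D, of "(\<zero>, _)"] RI by (fastforce simp: refl_on_def cA)
      show "sym R" using congruencesD(3)[OF D] RI unfolding sym_def R_def by blast
      show "trans R"
      proof (rule transI)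
        fix x y z assume "(x, y) \<in> R" "(y, z) \<in> R"
        then obtain c c' where c: "((\<zero>, x), (c, y)) \<in> D" and c': "((\<zero>, y), (c', z)) \<in> D"
          by (auto simp: R_def)
        \<comment> \<open>Translating the second relation by \<open>c\<close> makes it start where
          the first one ends.\<close>
        have "((c, y), (c \<oplus> c', z)) \<in> D" using tr[OF c', of c] cD[OF c] by simp
        then show "(x, z) \<in> R" using RI congruencesD(2)[OF D c] by blast
      qed
    qed
    moreover have "(oper Q f xs, oper Q f ys) \<in> R"
      if xs: "xs \<in> tuples (carrier Q) (ar f)" and ys: "ys \<in> tuples (carrier Q) (ar f)"
        and xy: "list_all2 (\<lambda>x y. (x, y) \<in> R) xs ys" for f xs ys
    proof -
      have "\<forall>z\<in>set (zip xs ys). \<exists>c. ((\<zero>, fst z), (c, snd z)) \<in> D"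
        using xy by (auto simp: list_all2_iff R_def)
      then obtain g where g: "\<And>z. z \<in> set (zip xs ys) \<Longrightarrow> ((\<zero>, fst z), (g z, snd z)) \<in> D"
        by metis
      have len: "length (zip xs ys) = ar f" "length xs = length ys"
        using xs ys by (auto simp: tuples_def)
      have "(oper A f (map (\<lambda>z. (\<zero>, fst z)) (zip xs ys)), oper A f (map (\<lambda>z. (g z, snd z)) (zip xs ys))) \<in> D"
        by (rule congruence_oper_map[OF D len(1) g])
      then have "(oper Q f (map fst (zip xs ys)), oper Q f (map snd (zip xs ys))) \<in> R"
        by (auto simp: A_def comp_def intro: RI)
      then show ?thesis using len(2) by simp
    qed
    ultimately show ?thesis by (auto simp: congruences_def)
  qed
  \<comment> \<open>Here the difference term enters: \<open>R\<close> is a congruence containing the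
    image of \<open>D\<close>, so it contains the derived congruence of \<open>Q\<close>.\<close>
  then have DQR: "DQ \<subseteq> R"
    unfolding DQ_def
    by (rule derived_cong_image[OF A ar mA Q snd surj]) (use RI in \<open>auto simp: D_def\<close>)
  \<comment> \<open>The reverse inclusion, from the projection being a homomorphism; together they
    identify \<open>R\<close> with \<open>DQ\<close>.\<close>
  have D_DQ: "(q, q') \<in> DQ" if "((b, q), (b', q')) \<in> D" for b q b' q'
    using derived_cong_hom[OF A snd] that by (auto simp: D_def DQ_def)
  have \<pi>: "\<pi> \<in> ua_hom ar Q P" unfolding \<pi>_def P_def by (rule canonical_hom_hom[OF DQ])
  have \<pi>_surj: "\<pi> ` carrier Q = carrier P" by (simp add: \<pi>_def P_def quotient_carrier)
  have \<pi>_eq: "\<pi> x = \<pi> y \<longleftrightarrow> (x, y) \<in> DQ" if "x \<in> carrier Q" "y \<in> carrier Q" for x y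
    unfolding \<pi>_def using canonical_hom_eq_iff[OF DQ that] .
  have "\<forall>p\<in>carrier P. \<exists>q. q \<in> carrier Q \<and> \<pi> q = p" unfolding \<pi>_surj[symmetric] by auto
  then obtain r where r: "\<And>p. p \<in> carrier P \<Longrightarrow> r p \<in> carrier Q" "\<And>p. p \<in> carrier P \<Longrightarrow> \<pi> (r p) = p"
    by metis
  have \<pi>P: "\<pi> q \<in> carrier P" if "q \<in> carrier Q" for q using that \<pi>_surj by auto
  have "(q, r (\<pi> q)) \<in> R" if "q \<in> carrier Q" for q
    using \<pi>_eq[OF that r(1)[OF \<pi>P[OF that]]] r(2)[OF \<pi>P[OF that]] DQR by auto
  then have "\<forall>q\<in>carrier Q. \<exists>c. ((\<zero>, q), (c, r (\<pi> q))) \<in> D" by (auto simp: R_def)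
  then obtain h where h: "\<And>q. q \<in> carrier Q \<Longrightarrow> ((\<zero>, q), (h q, r (\<pi> q))) \<in> D" by metis
  have hc: "h q \<in> carrier M" if "q \<in> carrier Q" for q using cD[OF h[OF that]] by simp
  have h_shift: "((c, q), (c \<oplus> h q, r (\<pi> q))) \<in> D" if "q \<in> carrier Q" "c \<in> carrier M" for q c
    using tr[OF h[OF that(1)] that(2)] that by simp
  \<comment> \<open>Both elements are \<open>D\<close>-related to elements over the same
    representative, and those must coincide by \<open>uniq\<close>. Thus \<open>b\<close> \<oplus>
    \<open>h q\<close> depends only on the \<open>D\<close>-class of (\<open>b\<close>,
    \<open>q\<close>).\<close>
  have h_eq: "b \<oplus> h q = b' \<oplus> h q'" if d: "((b, q), (b', q')) \<in> D" for b q b' q'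
  proof -
    have "\<pi> q = \<pi> q'" using \<pi>_eq[OF cD(2,4)[OF d]] D_DQ[OF d] by simp
    then have "((b \<oplus> h q, r (\<pi> q)), (b' \<oplus> h q', r (\<pi> q))) \<in> D"
      using h_shift cD[OF d] d congruencesD(2,3)[OF D] by metis
    then show ?thesis by (rule uniq)
  qed
  \<comment> \<open>The corrected cocycle, read off at representatives. The summand
    \<open>oper B f (map h _)\<close> of the correction is absent because \<open>h\<close> vanishes
    on representatives, by \<open>uniq\<close>.\<close>
  define S where "S f = (\<lambda>ps\<in>tuples (carrier P) (ar f). T f (map r ps) \<oplus> h (oper Q f (map r ps)))" for f
  have rs: "map r ps \<in> tuples (carrier Q) n" if "ps \<in> tuples (carrier P) n" for ps n
    by (rule map_tuples[OF that r(1)])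
  have \<pi>s: "map \<pi> qs \<in> tuples (carrier P) n" if "qs \<in> tuples (carrier Q) n" for qs n
    by (rule map_tuples[OF that \<pi>P])
  have Qc: "oper Q f qs \<in> carrier Q" if "qs \<in> tuples (carrier Q) (ar f)" for f qs
    using that Q by (auto simp: ualgebra_def)
  have S: "S \<in> cocycles ar M P"
    using cocycle_closed[OF T rs] hc[OF Qc[OF rs]] by (auto simp: cocycles_def S_def)
  have key: "S f (map \<pi> qs) \<oplus> oper B f (map h qs) = T f qs \<oplus> h (oper Q f qs)"
    if qs: "qs \<in> tuples (carrier Q) (ar f)" for f qs
  proof -
    let ?rs = "map r (map \<pi> qs)"
    have len: "length qs = ar f" and q: "\<And>q. q \<in> set qs \<Longrightarrow> q \<in> carrier Q"
      using qs by (auto simp: tuples_def)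
    have rqs: "?rs \<in> tuples (carrier Q) (ar f)" using rs[OF \<pi>s[OF qs]] .
    have c: "T f qs \<in> carrier M" "T f ?rs \<in> carrier M" "h (oper Q f ?rs) \<in> carrier M"
      "oper B f (map h qs) \<in> carrier M"
      using cocycle_closed[OF T qs] cocycle_closed[OF T rqs] hc[OF Qc[OF rqs]]
        oper_map_closed[OF len hc[OF q]] by auto
    have "map fst (map (\<lambda>q. (\<zero>, q)) qs) = map (\<lambda>q. \<zero>) qs" "map snd (map (\<lambda>q. (\<zero>, q)) qs) = qs"
      "map fst (map (\<lambda>q. (h q, r (\<pi> q))) qs) = map h qs" "map snd (map (\<lambda>q. (h q, r (\<pi> q))) qs) = ?rs"
      by (auto simp: comp_def)
    \<comment> \<open>The operation \<open>f\<close> is applied in \<open>A\<close> to the related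
      tuples (0, q) and (h q, r (\<pi> q)). Comparing the two values by \<open>h_eq\<close> gives
      the coboundary equation.\<close>
    then have "((T f qs, oper Q f qs), (oper B f (map h qs) \<oplus> T f ?rs, oper Q f ?rs)) \<in> D"
      using congruence_oper_map[OF D len, of "\<lambda>q. (\<zero>, q)" "\<lambda>q. (h q, r (\<pi> q))"] h[OF q] c
        oper_map_zero[OF len]
      unfolding A_def twisted_oper by (simp del: map_map)
    from h_eq[OF this] show ?thesis
      using \<pi>s[OF qs] c by (simp add: S_def a_ac del: map_map)
  qed
  have "cohomologous Q (pull_cocycle ar Q \<pi> S) T"
    unfolding cohomologous_def
    by (rule bexI[of _ h]) (use key hc in \<open>auto simp: pull_cocycle_def\<close>)
  moreover have "abelian_ualg ar (twisted_product M B S P)"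
  proof (rule abelian_image[OF A ar mA])
    \<comment> \<open>This map is a homomorphism by \<open>key\<close> and identifies
      \<open>D\<close>-related elements by \<open>h_eq\<close> and \<open>D_DQ\<close>; a preimage
      of (b, p) is found by subtracting \<open>h (r p)\<close>.\<close>
    let ?\<phi> = "\<lambda>x. (fst x \<oplus> h (snd x), \<pi> (snd x))"
    let ?C = "twisted_product M B S P"
    have "?\<phi> (oper A f xs) = oper ?C f (map ?\<phi> xs)" if xs: "xs \<in> tuples (carrier A) (ar f)" for f xs
    proof -
      let ?qs = "map snd xs"
      have x: "fst x \<in> carrier M" "snd x \<in> carrier Q" if "x \<in> set xs" for x
        using xs that by (auto simp: tuples_def cA)
      have qs: "?qs \<in> tuples (carrier Q) (ar f)" by (rule map_tuples[OF xs]) (auto simp: cA)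
      have len: "length xs = ar f" using xs by (simp add: tuples_def)
      have c: "T f ?qs \<in> carrier M" "h (oper Q f ?qs) \<in> carrier M" "oper B f (map h ?qs) \<in> carrier M"
        "oper B f (map fst xs) \<in> carrier M" "S f (map \<pi> ?qs) \<in> carrier M"
        using cocycle_closed[OF T qs] hc[OF Qc[OF qs]] oper_map_closed[OF len, of fst]
          map_closed[OF Pi_I[OF hc] qs] cocycle_closed[OF S \<pi>s[OF qs]] hc x len by auto
      have "oper B f (map fst (map ?\<phi> xs)) = oper B f (map fst xs) \<oplus> oper B f (map h ?qs)"
        using oper_map_add[OF len, of fst "\<lambda>x. h (snd x)"] x hc by (simp add: comp_def)
      then have "fst (oper ?C f (map ?\<phi> xs)) =
          oper B f (map fst xs) \<oplus> (S f (map \<pi> ?qs) \<oplus> oper B f (map h ?qs))"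
        using c by (simp add: a_ac comp_def)
      also have "\<dots> = fst (?\<phi> (oper A f xs))"
        unfolding key[OF qs] using c by (simp add: A_def a_assoc)
      finally have "fst (?\<phi> (oper A f xs)) = fst (oper ?C f (map ?\<phi> xs))" ..
      moreover have "snd (?\<phi> (oper A f xs)) = snd (oper ?C f (map ?\<phi> xs))"
      proof -
        have "\<pi> (oper Q f ?qs) = oper P f (map \<pi> ?qs)" using \<pi> qs by (auto simp: ua_hom_def)
        then show ?thesis by (simp add: A_def comp_def)
      qed
      ultimately show ?thesis by (rule prod_eqI)
    qed
    then show "?\<phi> \<in> ua_hom ar A ?C" using hc \<pi>P by (auto simp: ua_hom_def cA)
    show "?\<phi> ` carrier A = carrier ?C"
    proof (intro equalityI subsetI)
      fix y assume "y \<in> carrier ?C"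
      then obtain b p where y: "y = (b, p)" "b \<in> carrier M" "p \<in> carrier P" by auto
      then have "y = ?\<phi> (b \<ominus> h (r p), r p)" "(b \<ominus> h (r p), r p) \<in> carrier A"
        using r hc by (auto simp: cA minus_eq a_assoc l_neg)
      then show "y \<in> ?\<phi> ` carrier A" by (rule image_eqI)
    qed (use hc \<pi>P in \<open>auto simp: cA\<close>)
    show "?\<phi> x = ?\<phi> y" if "(x, y) \<in> derived_cong ar A" for x y
      using that h_eq[of "fst x" "snd x" "fst y" "snd y"] D_DQ[of "fst x" "snd x" "fst y" "snd y"]
        cD[of "fst x" "snd x" "fst y" "snd y"] \<pi>_eq by (simp add: D_def)
  qed
  ultimately show ?thesis using that S by (simp add: \<pi>_def P_def DQ_def)
qed

end

section \<open>Transport along an isomorphism over the base\<close>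

lemma ua_iso_inverse:
  assumes A: "ualgebra ar A" and \<psi>: "\<psi> \<in> ua_iso ar A C"
  shows "inv_into (carrier A) \<psi> \<in> ua_hom ar C A"
proof -
  let ?i = "inv_into (carrier A) \<psi>"
  have bij: "bij_betw \<psi> (carrier A) (carrier C)"
    and hom: "\<And>f xs. xs \<in> tuples (carrier A) (ar f) \<Longrightarrow> \<psi> (oper A f xs) = oper C f (map \<psi> xs)"
    using \<psi> by (auto simp: ua_iso_def ua_hom_def)
  have i: "?i y \<in> carrier A" "\<psi> (?i y) = y" if "y \<in> carrier C" for y
    using bij that by (auto simp: bij_betw_def inv_into_into f_inv_into_f)
  have "?i (oper C f ys) = oper A f (map ?i ys)" if ys: "ys \<in> tuples (carrier C) (ar f)" for f ys
  proof -
    have xs: "map ?i ys \<in> tuples (carrier A) (ar f)" by (rule map_tuples[OF ys i(1)])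
    have "map \<psi> (map ?i ys) = ys" using i(2) ys by (auto simp: tuples_def intro!: map_idI)
    then have "oper C f ys = \<psi> (oper A f (map ?i ys))" using hom[OF xs] by simp
    moreover have "oper A f (map ?i ys) \<in> carrier A" using A xs by (auto simp: ualgebra_def)
    ultimately show ?thesis using bij by (simp add: bij_betw_def inv_into_f_f)
  qed
  then show ?thesis using i by (auto simp: ua_hom_def)
qed

text \<open>The inverse isomorphism carries the derived congruence of \<open>C\<close> into that of
  \<open>A\<close> and respects the maps to the base. This replaces an arbitrary realizing extension
  by a twisted product.\<close>

lemma derived_cong_iso_trivial_ker:
  assumes A: "ualgebra ar A" and C: "ualgebra ar C" and \<psi>: "\<psi> \<in> ua_iso ar A C"
    and \<rho>: "\<And>a. a \<in> carrier A \<Longrightarrow> \<sigma> (\<psi> a) = \<rho> a"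
    and ker: "ker_cong A \<rho> \<inter> derived_cong ar A = least_cong A"
  shows "ker_cong C \<sigma> \<inter> derived_cong ar C = least_cong C"
proof -
  let ?i = "inv_into (carrier A) \<psi>"
  have i: "?i y \<in> carrier A" "\<psi> (?i y) = y" if "y \<in> carrier C" for y
    using \<psi> that by (auto simp: ua_iso_def bij_betw_def inv_into_into f_inv_into_f)
  have "x = y" if xy: "(x, y) \<in> ker_cong C \<sigma> \<inter> derived_cong ar C" for x y
  proof -
    have c: "x \<in> carrier C" "y \<in> carrier C" "\<sigma> x = \<sigma> y" using xy by (auto simp: ker_cong_def)
    then have "\<rho> (?i x) = \<rho> (?i y)" using \<rho>[OF i(1)] i(2) by metis
    then have "(?i x, ?i y) \<in> ker_cong A \<rho> \<inter> derived_cong ar A"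
      using derived_cong_hom[OF C ua_iso_inverse[OF A \<psi>]] i c xy by (auto simp: ker_cong_def)
    then have "?i x = ?i y" using ker by (auto simp: least_cong_def)
    then show ?thesis using i(2) c by metis
  qed
  then show ?thesis
    using congruencesD(4)[OF derived_cong_congruence[OF C]]
    by (auto simp: ker_cong_def least_cong_def)
qed

lemma compatible_cocycles_iff:
  "T \<in> carrier (compatible_cocycles ar E M B Q) \<longleftrightarrow> T \<in> cocycles ar M Q \<and> compatible ar E M B Q T"
  by (simp add: compatible_cocycles_def)

section \<open>Inflated classes and extensions with trivial kernel intersection\<close>

text \<open>A formula cannot quantify over the type of the elements of \<open>A\<close>. The
  equivalence therefore uses the type of the twisted product, to which every realizing extension is
  isomorphic; the second conjunct covers extensions on an arbitrary type.\<close>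

theorem lemma4p8:
  fixes ar :: "'f \<Rightarrow> nat"
    and E :: "(('f, nat) trm \<times> ('f, nat) trm) set"
    and m :: 'f
    and R :: "('r, 's) ring_scheme"
    and M :: "('r, 'b, 'e) module_scheme"
    and B :: "('f, 'b) ualg"
    and Q :: "('f, 'q) ualg"
    and T :: "('f, 'q, 'b) cochain"
  assumes "identities ar E"
    and "difference_term ar E m"
    and "central_datum ar E m R M B Q"
    and "T \<in> carrier (compatible_cocycles ar E M B Q)"
  shows "let D = derived_cong ar Q;
             P = quotient_ualg Q D;
             im_infl = inflation ar E M B Q (canonical_hom D) ` Ext ar E M B P;
             \<xi> = coh_class ar E M B Q T
         in (\<xi> \<in> im_infl \<longleftrightarrow>
               (\<exists>(A :: ('f, 'b \<times> 'q) ualg) \<rho>. realizes_with_class ar E M B Q A \<rho> \<xi> \<and>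
                  ker_cong A \<rho> \<inter> derived_cong ar A = least_cong A)) \<and>
            (\<forall>(A :: ('f, 'a) ualg) \<rho>. realizes_with_class ar E M B Q A \<rho> \<xi> \<and>
                  ker_cong A \<rho> \<inter> derived_cong ar A = least_cong A \<longrightarrow> \<xi> \<in> im_infl)"
proof -
  define D where "D = derived_cong ar Q"
  define P where "P = quotient_ualg Q D"
  define \<pi> where "\<pi> = canonical_hom D"
  define \<xi> where "\<xi> = coh_class ar E M B Q T"
  define im_infl where "im_infl = inflation ar E M B Q \<pi> ` Ext ar E M B P"
  note E = assms(1)
  have ar: "ar m = 3" using assms(2) by (simp add: difference_term_def)
  have K: "kernel_algebra ar m R M B" and B: "in_variety ar E B" and Qv: "in_variety ar E Q"
    using assms(3) by (auto simp: central_datum_def)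
  have uB: "ualgebra ar B" and Q: "ualgebra ar Q" using B Qv by (auto simp: in_variety_def)
  interpret additive_ualg M ar B by (rule kernel_algebra_additive[OF K uB])
  have mB: "oper B m [x, y, z] = x \<ominus>\<^bsub>M\<^esub> y \<oplus>\<^bsub>M\<^esub> z"
    if "x \<in> carrier M" "y \<in> carrier M" "z \<in> carrier M" for x y z
    using K that by (simp add: kernel_algebra_def)
  have Dc: "D \<in> congruences ar Q" unfolding D_def by (rule derived_cong_congruence[OF Q])
  have \<pi>: "\<pi> \<in> ua_hom ar Q P" unfolding \<pi>_def P_def by (rule canonical_hom_hom[OF Dc])
  have surj: "\<pi> ` carrier Q = carrier P" by (simp add: \<pi>_def P_def quotient_carrier)
  have P: "ualgebra ar P" by (rule ualgebra_image[OF Q \<pi> surj])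

  have realized: "\<exists>(A :: ('f, 'b \<times> 'q) ualg) \<rho>. realizes_with_class ar E M B Q A \<rho> \<xi> \<and>
      ker_cong A \<rho> \<inter> derived_cong ar A = least_cong A" if im: "\<xi> \<in> im_infl"
  proof -
    from im obtain S where S: "S \<in> cocycles ar M P" "compatible ar E M B P S"
      and \<xi>: "\<xi> = inflation ar E M B Q \<pi> (coh_class ar E M B P S)"
      and ab: "abelian_ualg ar (twisted_product M B S P)"
      by (auto simp: im_infl_def Ext_def compatible_cocycles_iff)
    \<comment> \<open>The extension is built from the inflated representative \<open>U\<close> of
      the class, not from \<open>T\<close>, so that (b, q) \<mapsto> (b, \<pi> q) is a homomorphism
      without any correction.\<close>
    define U where "U = pull_cocycle ar Q \<pi> S"
    define A where "A = twisted_product M B U Q"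
    have U: "U \<in> cocycles ar M Q" unfolding U_def by (rule pull_cocycle_closed[OF \<pi> S(1)])
    have Uc: "compatible ar E M B Q U"
      unfolding U_def compatible_pull_iff[OF Q \<pi> surj] by (rule S(2))
    have \<xi>U: "\<xi> = coh_class ar E M B Q U"
      unfolding \<xi> U_def by (rule inflation_coh_class[OF Q P \<pi> S(1)])
    have Av: "in_variety ar E A" unfolding A_def by (rule twisted_in_variety[OF E B Qv U Uc])
    then have A: "ualgebra ar A" by (simp add: in_variety_def)
    have "id \<in> ua_iso ar A (twisted_product M B U Q)"
      using A by (auto simp: ua_iso_def ua_hom_def A_def)
    then have "realizes_with_class ar E M B Q A snd \<xi>"
      using Av twisted_central[OF Q U] U Uc \<xi>U
      unfolding realizes_with_class_def
      by (intro conjI bexI[of _ U] bexI[of _ id]) (simp_all add: A_def compatible_cocycles_iff)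
    moreover have "ker_cong A snd \<inter> derived_cong ar A = least_cong A"
    proof -
      \<comment> \<open>The target is abelian, so elements related by the derived congruence have
        equal images and hence equal \<open>B\<close>-coordinates. Inside a fibre the
        \<open>Q\<close>-coordinates agree as well.\<close>
      define \<phi> :: "'b \<times> 'q \<Rightarrow> 'b \<times> 'q set" where "\<phi> = map_prod id \<pi>"
      have "\<phi> (oper A f xs) = oper (twisted_product M B S P) f (map \<phi> xs)"
        if xs: "xs \<in> tuples (carrier A) (ar f)" for f xs
      proof -
        have qs: "map snd xs \<in> tuples (carrier Q) (ar f)"
          by (rule map_tuples[OF xs]) (auto simp: A_def)
        then have "\<pi> (oper Q f (map snd xs)) = oper P f (map \<pi> (map snd xs))"
          using \<pi> unfolding ua_hom_def by blast
        moreover have "map fst (map \<phi> xs) = map fst xs" "map snd (map \<phi> xs) = map \<pi> (map snd xs)"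
          by (simp_all add: \<phi>_def)
        ultimately show ?thesis
          using qs by (simp add: A_def \<phi>_def U_def pull_cocycle_def del: map_map)
      qed
      then have \<phi>: "\<phi> \<in> ua_hom ar A (twisted_product M B S P)"
        using surj by (auto simp: ua_hom_def A_def \<phi>_def)
      have "x = y" if "(x, y) \<in> ker_cong A snd \<inter> derived_cong ar A" for x y
      proof -
        have "(\<phi> x, \<phi> y) \<in> least_cong (twisted_product M B S P)"
          using derived_cong_hom[OF A \<phi>, of x y] that ab by (simp add: abelian_ualg_def)
        then have "fst x = fst y" by (auto simp: least_cong_def \<phi>_def map_prod_def split: prod.splits)
        then show ?thesis using that by (auto simp: ker_cong_def prod_eq_iff)
      qed
      then show ?thesis
        using congruencesD(4)[OF derived_cong_congruence[OF A]]
        by (auto simp: ker_cong_def least_cong_def)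
    qed
    ultimately show ?thesis by blast
  qed

  \<comment> \<open>The type variable \<open>'c\<close> is fresh, so this fact can be used both for
    the product type and for the type \<open>'a\<close> of the second conjunct.\<close>
  have inflated: "\<xi> \<in> im_infl" if rz: "realizes_with_class ar E M B Q A \<rho> \<xi>"
    and ker: "ker_cong A \<rho> \<inter> derived_cong ar A = least_cong A" for A :: "('f, 'c) ualg" and \<rho>
  proof -
    from rz obtain U \<psi> where A: "ualgebra ar A" and U: "U \<in> cocycles ar M Q" "compatible ar E M B Q U"
      and \<xi>U: "\<xi> = coh_class ar E M B Q U" and \<psi>: "\<psi> \<in> ua_iso ar A (twisted_product M B U Q)"
      and \<rho>: "\<And>a. a \<in> carrier A \<Longrightarrow> snd (\<psi> a) = \<rho> a"
      by (auto simp: realizes_with_class_def in_variety_def compatible_cocycles_iff)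
    have mU: "difference_operation ar (twisted_product M B U Q) m"
      by (rule difference_term_all_types[OF E assms(2) twisted_in_variety[OF E B Qv U]])
    have kerU: "ker_cong (twisted_product M B U Q) snd \<inter> derived_cong ar (twisted_product M B U Q)
        = least_cong (twisted_product M B U Q)"
      by (rule derived_cong_iso_trivial_ker[OF A twisted_ualgebra[OF Q U(1)] \<psi> \<rho> ker])
    obtain S where S: "S \<in> cocycles ar M P" and coh: "cohomologous Q (pull_cocycle ar Q \<pi> S) U"
      and ab: "abelian_ualg ar (twisted_product M B S P)"
      using descends_to_abelianization[OF Q U(1) ar mB mU kerU] by (auto simp: P_def \<pi>_def D_def)
    have pS: "pull_cocycle ar Q \<pi> S \<in> cocycles ar M Q" by (rule pull_cocycle_closed[OF \<pi> S])
    \<comment> \<open>The pullback of \<open>S\<close> is cohomologous to the compatible cocycle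
      \<open>U\<close>, hence compatible, and compatibility descends along the surjection
      \<pi>.\<close>
    have Sc: "compatible ar E M B P S"
      using compatible_cohomologous[OF E B Qv pS U(1) coh U(2)] compatible_pull_iff[OF Q \<pi> surj] by blast
    have "coh_class ar E M B P S \<in> Ext ar E M B P"
      using S Sc ab by (auto simp: Ext_def H2_def FactGroup_def RCOSETS_def coh_class_def compatible_cocycles_iff)
    moreover have "\<xi> = inflation ar E M B Q \<pi> (coh_class ar E M B P S)"
      using coh coh_class_eq_iff[OF Q pS U(1)] by (simp add: inflation_coh_class[OF Q P \<pi> S] \<xi>U)
    ultimately show ?thesis unfolding im_infl_def by (rule rev_image_eqI)
  qed

  show ?thesis
    unfolding Let_def D_def[symmetric] \<pi>_def[symmetric] P_def[symmetric] \<xi>_def[symmetric]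
      im_infl_def[symmetric]
    by (intro conjI iffI allI impI; (elim exE conjE)?) (erule realized inflated, assumption?)+
qed

end
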